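(* Let $s=(s_1,\dots,s_n)$ and $\tilde s=(\tilde s_1,\dots,\tilde s_{\tilde n})$ be sequences of simple reflections and let $(p,w,\phi)$ be a morphism from $s$ to $\tilde s$ in the folding category $\widetilde{\mathbf{Seq}}$, i.e. $p:\{1,\dots,n\}\to\{1,\dots,\tilde n\}$ is a strictly increasing map, $w\in W$, and $\phi:\Gamma(s)\to\Gamma(\tilde s)$ is a map such that $$\phi(\gamma)^{p(i)}\,\tilde s_{p(i)}\,(\phi(\gamma)^{p(i)})^{-1}=w\gamma^is_i(\gamma^i)^{-1}w^{-1},\qquad \phi(\mathbf f_i\gamma)=\mathbf f_{p(i)}\phi(\gamma)$$ for any $\gamma\in\Gamma(s)$ and $i=1,\dots,n$. Then there exists a continuous map $\psi:\mathrm{BS}_c(s)\to\mathrm{BS}_c(\tilde s)$ such that $\psi(ka)=\dot wk\dot w^{-1}\psi(a)$ for any $k\in K$ and $a\in\mathrm{BS}_c(s)$, and such that the restriction $\psi^K:\mathrm{BS}_c(s)^K\to\mathrm{BS}_c(\tilde s)^K$ of $\psi$ to $K$-fixed points equals $\phi$ (under the identifications $\mathrm{BS}_c(s)^K=\Gamma(s)$, $\mathrm{BS}_c(\tilde s)^K=\Gamma(\tilde s)$).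
   Context: Groups. $G$ is a semisimple complex (Chevalley) group with root system $\Phi$ and set of simple roots $\Pi$, generated by root elements $x_\alpha(t)$ ($\alpha\in\Phi$, $t\in\mathbb C$). Put $w_\alpha(t)=x_\alpha(t)x_{-\alpha}(-t^{-1})x_\alpha(t)$, $\omega_\alpha=w_\alpha(1)$, $h_\alpha(t)=w_\alpha(t)\omega_\alpha^{-1}$; $T$ is the maximal torus generated by all $h_\alpha(t)$. Let $\sigma$ be the analytic automorphism of $G$ with $\sigma(x_\alpha(t))=x_{-\alpha}(-\bar t)$, $C=G^\sigma$, $K=T^\sigma$ (compact torus). $W$ is the Weyl group, $s_\alpha$ the reflection of $\alpha$; simple reflections are the $s_\alpha$ with $\alpha\in\Pi$. Let $\varphi_\alpha:\mathrm{SL}_2(\mathbb C)\to G$ be the homomorphism sending upper/lower unitriangular matrices with entry $t$ to $x_\alpha(t)$/$x_{-\alpha}(t)$; $C_{s_\alpha}=\varphi_\alpha(\mathrm{SU}_2)K$. Let $\mathcal N\subset C$ be generated by all $\omega_\alpha$ and $K$; $W\cong\mathcal N/K$ via $s_\alpha\mapsto\omega_\alpha K$. Fix a representative $\dot w\in\mathcal N$ of every $w\in W$. Spaces. For $s=(s_1,\dots,s_n)$ a sequence of reflections, $C(s)=\prod_{i=1}^nC_{s_i}$, on which $K^n$ acts on the right by $(ck)_i=k_{i-1}^{-1}c_ik_i$ (with $k_0=1$); $\mathrm{BS}_c(s)=C(s)/K^n$, $[c]$ is the class of $c$, and $K$ acts on the left by $k[(c_1,c_2,\dots,c_n)]=[(kc_1,c_2,\dots,c_n)]$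 (trivially on the one-point space if $n=0$). Galleries. $\Gamma(s)=\{\gamma=(\gamma_1,\dots,\gamma_n)\mid\gamma_i\in\{1,s_i\}\}$. For $\gamma\in\Gamma(s)$, $\gamma^i=\gamma_1\gamma_2\cdots\gamma_i\in W$; $\mathbf f_i\gamma\in\Gamma(s)$ is given by $(\mathbf f_i\gamma)_i=\gamma_is_i$ and $(\mathbf f_i\gamma)_j=\gamma_j$ for $j\ne i$. One has $\mathrm{BS}_c(s)^K=\{[(\dot\gamma_1,\dots,\dot\gamma_n)]\mid\gamma\in\Gamma(s)\}$, and this set is identified with $\Gamma(s)$. *)

theory Defs
  imports "HOL-Analysis.Analysis" "HOL-Algebra.Generated_Groups" "HOL-Algebra.Bij"
begin

section \<open>Root systems and Weyl groups\<close>

definition coroot :: "'e::euclidean_space \<Rightarrow> 'e" where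
  "coroot \<alpha> = (2 / (\<alpha> \<bullet> \<alpha>)) *\<^sub>R \<alpha>"

definition reflection :: "'e::euclidean_space \<Rightarrow> 'e \<Rightarrow> 'e" where
  "reflection \<alpha> v = v - (v \<bullet> coroot \<alpha>) *\<^sub>R \<alpha>"

text \<open>
  Reduced crystallographic root systems. The roots are not required to span the ambient space:
  \<open>\<Phi>\<close> is a root system in \<open>span \<Phi>\<close>, and the reflections fix the orthogonal complement pointwise.
\<close>
definition root_system :: "'e::euclidean_space set \<Rightarrow> bool" where
  "root_system \<Phi> \<longleftrightarrow>
     finite \<Phi> \<and> 0 \<notin> \<Phi> \<and>
     (\<forall>\<alpha>\<in>\<Phi>. reflection \<alpha> ` \<Phi> = \<Phi>) \<and>
     (\<forall>\<alpha>\<in>\<Phi>. \<forall>\<beta>\<in>\<Phi>. \<beta> \<bullet> coroot \<alpha> \<in> \<int>) \<and>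
     (\<forall>\<alpha>\<in>\<Phi>. \<forall>c. c *\<^sub>R \<alpha> \<in> \<Phi> \<longrightarrow> c = 1 \<or> c = -1)"

definition root_base :: "'e::euclidean_space set \<Rightarrow> 'e set \<Rightarrow> bool" where
  "root_base \<Phi> \<Delta> \<longleftrightarrow>
     \<Delta> \<subseteq> \<Phi> \<and> independent \<Delta> \<and>
     (\<forall>\<beta>\<in>\<Phi>. \<exists>c::'e \<Rightarrow> int. \<beta> = (\<Sum>\<alpha>\<in>\<Delta>. of_int (c \<alpha>) *\<^sub>R \<alpha>) \<and>
        ((\<forall>\<alpha>\<in>\<Delta>. c \<alpha> \<ge> 0) \<or> (\<forall>\<alpha>\<in>\<Delta>. c \<alpha> \<le> 0)))"

definition weyl_group :: "'e::euclidean_space set \<Rightarrow> ('e \<Rightarrow> 'e) monoid" where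
  "weyl_group \<Phi> =
     (BijGroup UNIV)\<lparr>carrier := generate (BijGroup UNIV) (reflection ` \<Phi>)\<rparr>"


section \<open>Complex Chevalley groups\<close>

type_synonym 'n cmat = "complex ^ 'n ^ 'n"

definition GL :: "'n::finite cmat monoid" where
  "GL = \<lparr>carrier = {A. invertible A}, mult = (**), one = mat 1\<rparr>"

definition SL2 :: "2 cmat monoid" where
  "SL2 = \<lparr>carrier = {A. det A = 1}, mult = (**), one = mat 1\<rparr>"

definition SU2 :: "2 cmat set" where
  "SU2 = {A. det A = 1 \<and> A ** transpose (map_matrix cnj A) = mat 1}"

definition upper_unitri :: "complex \<Rightarrow> 2 cmat" where
  "upper_unitri t = vector [vector [1, t], vector [0, 1]]"

definition lower_unitri :: "complex \<Rightarrow> 2 cmat" where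
  "lower_unitri t = vector [vector [1, 0], vector [t, 1]]"

definition lie_bracket :: "'n::finite cmat \<Rightarrow> 'n cmat \<Rightarrow> 'n cmat" where
  "lie_bracket A B = A ** B - B ** A"

definition mat_exp :: "'n::finite cmat \<Rightarrow> 'n cmat" where
  "mat_exp A = (\<Sum>k. (1 / fact k) *\<^sub>R (((**) A ^^ k) (mat 1)))"

text \<open>
  Scalar multiplication of matrices is written \<open>mat c ** A\<close>. The predicate says that the \<open>X \<alpha>\<close>
  together with \<open>[X \<alpha>, X (- \<alpha>)]\<close>, \<open>\<alpha> \<in> \<Delta>\<close>, form a Chevalley basis of a Lie algebra of matrices
  with root system \<open>\<Phi>\<close>: this is the image of the abstract complex semisimple Lie algebra of type \<open>\<Phi>\<close>
  under a faithful finite-dimensional representation. The linear map \<open>H\<close> identifies the real span of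
  the coroots with the real form of the Cartan subalgebra.
\<close>
definition chevalley_basis ::
  "'e::euclidean_space set \<Rightarrow> 'e set \<Rightarrow> ('e \<Rightarrow> 'n::finite cmat) \<Rightarrow> bool" where
  "chevalley_basis \<Phi> \<Delta> X \<longleftrightarrow>
     (\<exists>H. linear H \<and>
        (\<forall>\<alpha>\<in>\<Phi>. lie_bracket (X \<alpha>) (X (- \<alpha>)) = H (coroot \<alpha>)) \<and>
        (\<forall>\<alpha>\<in>\<Phi>. \<forall>\<beta>\<in>\<Phi>. lie_bracket (H (coroot \<alpha>)) (H (coroot \<beta>)) = 0) \<and>
        (\<forall>\<alpha>\<in>\<Phi>. \<forall>\<beta>\<in>\<Phi>. lie_bracket (H (coroot \<alpha>)) (X \<beta>)
            = mat (of_real (\<beta> \<bullet> coroot \<alpha>)) ** X \<beta>) \<and>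
        (\<forall>a b. (\<Sum>\<alpha>\<in>\<Phi>. mat (a \<alpha>) ** X \<alpha>) + (\<Sum>\<alpha>\<in>\<Delta>. mat (b \<alpha>) ** H (coroot \<alpha>)) = 0
            \<longrightarrow> (\<forall>\<alpha>\<in>\<Phi>. a \<alpha> = 0) \<and> (\<forall>\<alpha>\<in>\<Delta>. b \<alpha> = 0))) \<and>
     (\<exists>N. \<forall>\<alpha>\<in>\<Phi>. \<forall>\<beta>\<in>\<Phi>. \<alpha> + \<beta> \<in> \<Phi> \<longrightarrow>
        lie_bracket (X \<alpha>) (X \<beta>) = mat (N \<alpha> \<beta>) ** X (\<alpha> + \<beta>) \<and>
        N (- \<alpha>) (- \<beta>) = - N \<alpha> \<beta>) \<and>
     (\<forall>\<alpha>\<in>\<Phi>. \<forall>\<beta>\<in>\<Phi>. \<alpha> + \<beta> \<notin> \<Phi> \<and> \<alpha> + \<beta> \<noteq> 0 \<longrightarrow> lie_bracket (X \<alpha>) (X \<beta>) = 0)"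

text \<open>
  \<open>sl2hom D \<alpha>\<close> is the homomorphism \<open>\<phi>\<^sub>\<alpha>\<close> from \<open>SL\<^sub>2\<close>, and \<open>rep D w\<close> is the chosen representative
  of the Weyl group element \<open>w\<close>.
\<close>
record ('e, 'n) chevalley_data =
  roots :: "'e set"
  simple_roots :: "'e set"
  root_vec :: "'e \<Rightarrow> complex ^ 'n ^ 'n"
  sigma :: "complex ^ 'n ^ 'n \<Rightarrow> complex ^ 'n ^ 'n"
  sl2hom :: "'e \<Rightarrow> complex ^ 2 ^ 2 \<Rightarrow> complex ^ 'n ^ 'n"
  rep :: "('e \<Rightarrow> 'e) \<Rightarrow> complex ^ 'n ^ 'n"

type_synonym ('e, 'n) chev = "('e, 'n) chevalley_data"

abbreviation weyl :: "('e::euclidean_space, 'n::finite) chev \<Rightarrow> ('e \<Rightarrow> 'e) monoid" where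
  "weyl D \<equiv> weyl_group (roots D)"

definition root_elt :: "('e::euclidean_space, 'n::finite) chev \<Rightarrow> 'e \<Rightarrow> complex \<Rightarrow> 'n cmat" where
  "root_elt D \<alpha> t = mat_exp (mat t ** root_vec D \<alpha>)"

definition chev_group :: "('e::euclidean_space, 'n::finite) chev \<Rightarrow> 'n cmat monoid" where
  "chev_group D = GL\<lparr>carrier := generate GL {root_elt D \<alpha> t |\<alpha> t. \<alpha> \<in> roots D}\<rparr>"

definition w_elt :: "('e::euclidean_space, 'n::finite) chev \<Rightarrow> 'e \<Rightarrow> complex \<Rightarrow> 'n cmat" where
  "w_elt D \<alpha> t = root_elt D \<alpha> t ** root_elt D (- \<alpha>) (- inverse t) ** root_elt D \<alpha> t"

abbreviation omega :: "('e::euclidean_space, 'n::finite) chev \<Rightarrow> 'e \<Rightarrow> 'n cmat" where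
  "omega D \<alpha> \<equiv> w_elt D \<alpha> 1"

definition h_elt :: "('e::euclidean_space, 'n::finite) chev \<Rightarrow> 'e \<Rightarrow> complex \<Rightarrow> 'n cmat" where
  "h_elt D \<alpha> t = w_elt D \<alpha> t ** matrix_inv (omega D \<alpha>)"

definition torus :: "('e::euclidean_space, 'n::finite) chev \<Rightarrow> 'n cmat set" where
  "torus D = generate GL {h_elt D \<alpha> t |\<alpha> t. \<alpha> \<in> roots D \<and> t \<noteq> 0}"

definition compact_torus :: "('e::euclidean_space, 'n::finite) chev \<Rightarrow> 'n cmat set" where
  "compact_torus D = {g \<in> torus D. sigma D g = g}"

definition Nrm :: "('e::euclidean_space, 'n::finite) chev \<Rightarrow> 'n cmat monoid" where
  "Nrm D = GL\<lparr>carrier := generate GL (omega D ` roots D \<union> compact_torus D)\<rparr>"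

text \<open>
  The automorphism \<open>\<sigma>\<close>, the homomorphisms \<open>\<phi>\<^sub>\<alpha>\<close> and the isomorphism \<open>\<iota>\<close> from \<open>W\<close> onto \<open>\<N>/K\<close>
  are each uniquely determined by their values on generators. In particular the analyticity of
  \<open>\<sigma>\<close> is automatic; only its continuity is recorded here. The topology of the group is the one
  induced from complex matrices.
\<close>
definition compact_chevalley :: "('e::euclidean_space, 'n::finite) chev \<Rightarrow> bool" where
  "compact_chevalley D \<longleftrightarrow>
     root_system (roots D) \<and> root_base (roots D) (simple_roots D) \<and>
     chevalley_basis (roots D) (simple_roots D) (root_vec D) \<and>
     sigma D \<in> iso (chev_group D) (chev_group D) \<and> continuous_on (carrier (chev_group D)) (sigma D) \<and>
     (\<forall>\<alpha>\<in>roots D. \<forall>t. sigma D (root_elt D \<alpha> t) = root_elt D (- \<alpha>) (- cnj t)) \<and>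
     (\<forall>\<alpha>\<in>roots D. sl2hom D \<alpha> \<in> hom SL2 (chev_group D) \<and>
        (\<forall>t. sl2hom D \<alpha> (upper_unitri t) = root_elt D \<alpha> t \<and>
             sl2hom D \<alpha> (lower_unitri t) = root_elt D (- \<alpha>) t)) \<and>
     (\<exists>\<iota>\<in>iso (weyl D) (Nrm D Mod compact_torus D).
        (\<forall>\<alpha>\<in>roots D. \<iota> (reflection \<alpha>) = omega D \<alpha> <#\<^bsub>GL\<^esub> compact_torus D) \<and>
        (\<forall>w\<in>carrier (weyl D). rep D w \<in> \<iota> w))"


section \<open>Bott--Samelson spaces\<close>

text \<open>
  A sequence \<open>(s\<^sub>1, \<dots>, s\<^sub>n)\<close> is given by its length \<open>n\<close> and a function \<open>s\<close> of which only the values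
  on \<open>{1..n}\<close> matter.
\<close>

text \<open>
  For a reflection \<open>s = s\<^sub>\<alpha>\<close> this is \<open>\<phi>\<^sub>\<alpha>(SU\<^sub>2) K\<close>. The root \<open>\<alpha>\<close> is determined by \<open>s\<close> up to sign, and
  \<open>\<alpha>\<close>, \<open>- \<alpha>\<close> give the same set.
\<close>
definition C_refl :: "('e::euclidean_space, 'n::finite) chev \<Rightarrow> ('e \<Rightarrow> 'e) \<Rightarrow> 'n cmat set" where
  "C_refl D s = {sl2hom D \<alpha> g ** k |\<alpha> g k. \<alpha> \<in> roots D \<and> reflection \<alpha> = s \<and> g \<in> SU2 \<and> k \<in> compact_torus D}"

definition C_seq ::
  "('e::euclidean_space, 'n::finite) chev \<Rightarrow> nat \<Rightarrow> (nat \<Rightarrow> 'e \<Rightarrow> 'e) \<Rightarrow> (nat \<Rightarrow> 'n cmat) set" where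
  "C_seq D n s = (\<Pi>\<^sub>E i\<in>{1..n}. C_refl D (s i))"

definition C_top ::
  "('e::euclidean_space, 'n::finite) chev \<Rightarrow> nat \<Rightarrow> (nat \<Rightarrow> 'e \<Rightarrow> 'e)
     \<Rightarrow> (nat \<Rightarrow> 'n cmat) topology" where
  "C_top D n s = product_topology (\<lambda>i. top_of_set (C_refl D (s i))) {1..n}"

definition right_act ::
  "nat \<Rightarrow> (nat \<Rightarrow> 'n::finite cmat) \<Rightarrow> (nat \<Rightarrow> 'n cmat) \<Rightarrow> nat \<Rightarrow> 'n cmat" where
  "right_act n c k =
     (\<lambda>i\<in>{1..n}. matrix_inv (if i = 1 then mat 1 else k (i - 1)) ** c i ** k i)"

definition bs_class ::
  "('e::euclidean_space, 'n::finite) chev \<Rightarrow> nat \<Rightarrow> (nat \<Rightarrow> 'n cmat) \<Rightarrow> (nat \<Rightarrow> 'n cmat) set" where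
  "bs_class D n c = right_act n c ` (\<Pi>\<^sub>E i\<in>{1..n}. compact_torus D)"

definition BS ::
  "('e::euclidean_space, 'n::finite) chev \<Rightarrow> nat \<Rightarrow> (nat \<Rightarrow> 'e \<Rightarrow> 'e)
     \<Rightarrow> (nat \<Rightarrow> 'n cmat) set set" where
  "BS D n s = bs_class D n ` C_seq D n s"

definition BS_top ::
  "('e::euclidean_space, 'n::finite) chev \<Rightarrow> nat \<Rightarrow> (nat \<Rightarrow> 'e \<Rightarrow> 'e)
     \<Rightarrow> (nat \<Rightarrow> 'n cmat) set topology" where
  "BS_top D n s = topology (\<lambda>U. U \<subseteq> BS D n s \<and>
     openin (C_top D n s) {c \<in> C_seq D n s. bs_class D n c \<in> U})"

definition left_mult :: "nat \<Rightarrow> 'n::finite cmat \<Rightarrow> (nat \<Rightarrow> 'n cmat) \<Rightarrow> nat \<Rightarrow> 'n cmat" where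
  "left_mult n k c = (\<lambda>i\<in>{1..n}. if i = 1 then k ** c i else c i)"

text \<open>Left multiplication commutes with the right action, so it acts on classes elementwise.\<close>
definition left_act ::
  "nat \<Rightarrow> 'n::finite cmat \<Rightarrow> (nat \<Rightarrow> 'n cmat) set \<Rightarrow> (nat \<Rightarrow> 'n cmat) set" where
  "left_act n k a = left_mult n k ` a"

definition BS_fixed ::
  "('e::euclidean_space, 'n::finite) chev \<Rightarrow> nat \<Rightarrow> (nat \<Rightarrow> 'e \<Rightarrow> 'e)
     \<Rightarrow> (nat \<Rightarrow> 'n cmat) set set" where
  "BS_fixed D n s = {a \<in> BS D n s. \<forall>k\<in>compact_torus D. left_act n k a = a}"

lemma topspace_C_top: "topspace (C_top D n s) = C_seq D n s"
  by (simp add: C_top_def C_seq_def)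

lemma openin_BS_top:
  "openin (BS_top D n s) U \<longleftrightarrow>
     U \<subseteq> BS D n s \<and> openin (C_top D n s) {c \<in> C_seq D n s. bs_class D n c \<in> U}"
proof -
  let ?P = "\<lambda>U. {c \<in> C_seq D n s. bs_class D n c \<in> U}"
  have "istopology (\<lambda>U. U \<subseteq> BS D n s \<and> openin (C_top D n s) (?P U))"
    unfolding istopology_def
  proof (intro conjI allI impI)
    fix A B assume A: "A \<subseteq> BS D n s \<and> openin (C_top D n s) (?P A)"
      and B: "B \<subseteq> BS D n s \<and> openin (C_top D n s) (?P B)"
    have "?P (A \<inter> B) = ?P A \<inter> ?P B" by auto
    with A B show "openin (C_top D n s) (?P (A \<inter> B))" by auto
    from A show "A \<inter> B \<subseteq> BS D n s" by auto
  next
    fix \<U> assume U: "\<forall>U\<in>\<U>. U \<subseteq> BS D n s \<and> openin (C_top D n s) (?P U)"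
    have "?P (\<Union>\<U>) = \<Union> (?P ` \<U>)" by auto
    moreover have "openin (C_top D n s) (\<Union> (?P ` \<U>))" using U by (intro openin_Union) auto
    ultimately show "openin (C_top D n s) (?P (\<Union>\<U>))" by simp
    from U show "\<Union>\<U> \<subseteq> BS D n s" by auto
  qed
  then show ?thesis by (simp add: BS_top_def topology_inverse')
qed

lemma topspace_BS_top: "topspace (BS_top D n s) = BS D n s"
proof -
  have "{c \<in> C_seq D n s. bs_class D n c \<in> BS D n s} = C_seq D n s"
    by (auto simp: BS_def)
  then have "openin (BS_top D n s) (BS D n s)"
    by (simp add: openin_BS_top flip: topspace_C_top)
  then show ?thesis
    by (meson openin_BS_top openin_subset openin_topspace subset_antisym)
qed

lemma quotient_map_bs_class: "quotient_map (C_top D n s) (BS_top D n s) (bs_class D n)"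
  by (auto simp: quotient_map_def topspace_BS_top topspace_C_top openin_BS_top BS_def)

lemma left_act_bs_class:
  fixes c :: "nat \<Rightarrow> 'n::finite cmat"
  shows "left_act n k (bs_class D n c) = bs_class D n (left_mult n k c)"
proof -
  have "matrix_inv (mat 1 :: 'n cmat) = mat 1"
    unfolding matrix_inv_def by (rule some_equality) auto
  then have "left_mult n k (right_act n c x) = right_act n (left_mult n k c) x"
    for x :: "nat \<Rightarrow> 'n cmat"
    by (auto simp: left_mult_def right_act_def fun_eq_iff matrix_mul_assoc)
  then show ?thesis
    by (simp add: left_act_def bs_class_def image_image)
qed


section \<open>Galleries and the folding category\<close>

definition galleries ::
  "('e::euclidean_space, 'n::finite) chev \<Rightarrow> nat \<Rightarrow> (nat \<Rightarrow> 'e \<Rightarrow> 'e)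
     \<Rightarrow> (nat \<Rightarrow> 'e \<Rightarrow> 'e) set" where
  "galleries D n s = (\<Pi>\<^sub>E i\<in>{1..n}. {\<one>\<^bsub>weyl D\<^esub>, s i})"

fun gal_prod ::
  "('e::euclidean_space, 'n::finite) chev \<Rightarrow> (nat \<Rightarrow> 'e \<Rightarrow> 'e) \<Rightarrow> nat \<Rightarrow> 'e \<Rightarrow> 'e" where
  "gal_prod D \<gamma> 0 = \<one>\<^bsub>weyl D\<^esub>"
| "gal_prod D \<gamma> (Suc i) = gal_prod D \<gamma> i \<otimes>\<^bsub>weyl D\<^esub> \<gamma> (Suc i)"

definition fold_at ::
  "('e::euclidean_space, 'n::finite) chev \<Rightarrow> (nat \<Rightarrow> 'e \<Rightarrow> 'e) \<Rightarrow> nat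
     \<Rightarrow> (nat \<Rightarrow> 'e \<Rightarrow> 'e) \<Rightarrow> nat \<Rightarrow> 'e \<Rightarrow> 'e" where
  "fold_at D s i \<gamma> = \<gamma>(i := \<gamma> i \<otimes>\<^bsub>weyl D\<^esub> s i)"

text \<open>
  The injection of galleries into the Bott--Samelson space whose image is the set of \<open>K\<close>-fixed
  points.
\<close>
definition gal_point ::
  "('e::euclidean_space, 'n::finite) chev \<Rightarrow> nat \<Rightarrow> (nat \<Rightarrow> 'e \<Rightarrow> 'e) \<Rightarrow> (nat \<Rightarrow> 'n cmat) set" where
  "gal_point D n \<gamma> = bs_class D n (\<lambda>i\<in>{1..n}. rep D (\<gamma> i))"

definition folding_morphism ::
  "('e::euclidean_space, 'n::finite) chev \<Rightarrow> nat \<Rightarrow> (nat \<Rightarrow> 'e \<Rightarrow> 'e) \<Rightarrow> nat \<Rightarrow> (nat \<Rightarrow> 'e \<Rightarrow> 'e)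
     \<Rightarrow> (nat \<Rightarrow> nat) \<Rightarrow> ('e \<Rightarrow> 'e) \<Rightarrow> ((nat \<Rightarrow> 'e \<Rightarrow> 'e) \<Rightarrow> nat \<Rightarrow> 'e \<Rightarrow> 'e) \<Rightarrow> bool" where
  "folding_morphism D n s n' s' p w \<phi> \<longleftrightarrow>
     p \<in> {1..n} \<rightarrow> {1..n'} \<and> strict_mono_on {1..n} p \<and>
     w \<in> carrier (weyl D) \<and>
     \<phi> \<in> galleries D n s \<rightarrow> galleries D n' s' \<and>
     (\<forall>\<gamma>\<in>galleries D n s. \<forall>i\<in>{1..n}.
        gal_prod D (\<phi> \<gamma>) (p i) \<otimes>\<^bsub>weyl D\<^esub> s' (p i) \<otimes>\<^bsub>weyl D\<^esub> inv\<^bsub>weyl D\<^esub> gal_prod D (\<phi> \<gamma>) (p i)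
          = w \<otimes>\<^bsub>weyl D\<^esub> gal_prod D \<gamma> i \<otimes>\<^bsub>weyl D\<^esub> s i \<otimes>\<^bsub>weyl D\<^esub> inv\<^bsub>weyl D\<^esub> gal_prod D \<gamma> i \<otimes>\<^bsub>weyl D\<^esub> inv\<^bsub>weyl D\<^esub> w \<and>
        \<phi> (fold_at D s i \<gamma>) = fold_at D s' (p i) (\<phi> \<gamma>))"

end

theory Submission
  imports Defs
begin

text \<open>
  Let \<open>\<delta>\<close> be the image under \<open>\<phi>\<close> of the gallery \<open>(1, \<dots>, 1)\<close>, let \<open>d\<^sub>j\<close> be the product of the
  chosen representatives of \<open>\<delta>\<^sub>1, \<dots>, \<delta>\<^sub>j\<close>, let \<open>g\<close> be that of \<open>w\<close>, and put \<open>m\<^sub>j = g\<^sup>-\<^sup>1 d\<^sub>j\<close>.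
  The map \<open>\<psi>\<close> is induced by sending \<open>c\<close> to the sequence with entries \<open>m\<^sub>j\<^sub>-\<^sub>1\<^sup>-\<^sup>1 c\<^sub>i m\<^sub>j\<close> for
  \<open>j = p i\<close> and \<open>m\<^sub>j\<^sub>-\<^sub>1\<^sup>-\<^sup>1 m\<^sub>j\<close> for \<open>j\<close> outside the image of \<open>p\<close>. This intertwines the action of
  \<open>(k\<^sub>i)\<close> with that of \<open>m\<^sub>j\<^sup>-\<^sup>1 k\<^sub>i m\<^sub>j\<close>, where \<open>i\<close> is the number of values of \<open>p\<close> that are at most
  \<open>j\<close>; allowing an arbitrary \<open>k\<^sub>0\<close> also gives the equivariance under \<open>K\<close>.

  That the entries lie in the right sets \<open>C\<^sub>s\<close> amounts to \<open>h C\<^sub>s h\<^sup>-\<^sup>1 = C\<^bsub>vsv\<^sup>-\<^sup>1\<^esub>\<close> for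
  \<open>h \<in> \<N>\<close> over \<open>v \<in> W\<close>. Conjugation by \<open>h\<close> permutes the weight spaces of the Lie algebra, so it
  multiplies the root vectors of \<open>\<alpha>\<close> and \<open>- \<alpha>\<close>, transported to \<open>v \<alpha>\<close> and \<open>- v \<alpha>\<close>, by
  scalars \<open>a\<close> and \<open>a\<^sup>-\<^sup>1\<close>. Since \<open>\<sigma>\<close> fixes \<open>h\<close>, \<open>\<bar>a\<bar> = 1\<close>, and hence conjugation maps
  \<open>\<phi>\<^sub>\<alpha>(SU\<^sub>2)\<close> to the corresponding group for \<open>v \<alpha>\<close>.
\<close>

section \<open>Matrices and the matrix exponential\<close>

lemma mat_mult_nth [simp]:
  fixes A :: "'a::semiring_1 ^ 'n ^ 'n::finite"
  shows "(mat c ** A) $ i $ j = c * A $ i $ j"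
  by (simp add: matrix_matrix_mult_def mat_def if_distrib [of "\<lambda>x. x * _"] sum.delta cong: if_cong)

lemma mult_mat_nth [simp]:
  fixes A :: "'a::semiring_1 ^ 'n ^ 'n::finite"
  shows "(A ** mat c) $ i $ j = A $ i $ j * c"
  by (simp add: matrix_matrix_mult_def mat_def if_distrib [of "\<lambda>x. _ * x"] sum.delta cong: if_cong)

lemma mat_comm:
  fixes A :: "'n::finite cmat"
  shows "A ** mat c = mat c ** A"
  by (simp add: vec_eq_iff mult.commute)

lemma mat_mult_mat:
  fixes A :: "'n::finite cmat"
  shows "mat a ** (mat b ** A) = mat (a * b) ** A"
  by (simp add: vec_eq_iff mult.assoc)

lemma mat_left_comm:
  fixes A :: "'n::finite cmat"
  shows "A ** (mat c ** B) = mat c ** (A ** B)"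
  by (metis mat_comm matrix_mul_assoc)

lemma mat_mult_eq_0_iff:
  fixes A :: "'n::finite cmat"
  shows "mat c ** A = 0 \<longleftrightarrow> c = 0 \<or> A = 0"
  by (auto simp: vec_eq_iff)

lemma mat_of_real_mult:
  fixes A :: "'n::finite cmat"
  shows "mat (of_real r) ** A = r *\<^sub>R A"
  by (simp only: vec_eq_iff mat_mult_nth vector_scaleR_component) (simp add: scaleR_conv_of_real)

lemma linear_matrix_mult_left: "linear (\<lambda>B :: 'n::finite cmat. A ** B)"
  and linear_matrix_mult_right: "linear (\<lambda>A :: 'n::finite cmat. A ** B)"
  by (auto intro!: linearI simp: vec_eq_iff matrix_matrix_mult_def sum.distrib
      scaleR_sum_right algebra_simps)

lemma bounded_bilinear_matrix_mult: "bounded_bilinear ((**) :: 'n::finite cmat \<Rightarrow> 'n cmat \<Rightarrow> 'n cmat)"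
  by (simp add: linear_matrix_mult_left linear_matrix_mult_right bilinear_def
      flip: bilinear_conv_bounded_bilinear)

interpretation mm: bounded_bilinear "(**) :: 'n::finite cmat \<Rightarrow> 'n cmat \<Rightarrow> 'n cmat"
  by (rule bounded_bilinear_matrix_mult)

lemma linear_lie_bracket: "linear (lie_bracket (E :: 'n::finite cmat))"
  unfolding lie_bracket_def
  by (intro linear_compose_sub linear_matrix_mult_left linear_matrix_mult_right)

lemma lie_bracket_mat:
  fixes A :: "'n::finite cmat"
  shows "lie_bracket A (mat c ** B) = mat c ** lie_bracket A B"
    and "lie_bracket (mat c ** A) B = mat c ** lie_bracket A B"
  by (simp_all add: lie_bracket_def mm.diff_right mat_left_comm matrix_mul_assoc [symmetric])

lemma lie_bracket_skew:
  fixes A :: "'n::finite cmat"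
  shows "lie_bracket B A = - lie_bracket A B"
  by (simp add: lie_bracket_def)

section \<open>Powers and the exponential series\<close>

definition mpow :: "'n::finite cmat \<Rightarrow> nat \<Rightarrow> 'n cmat" where
  "mpow A k = ((**) A ^^ k) (mat 1)"

lemma mpow_0 [simp]: "mpow A 0 = mat 1"
  and mpow_Suc [simp]: "mpow A (Suc k) = A ** mpow A k"
  by (simp_all add: mpow_def)

text \<open>Boundedness of the bilinear matrix product gives a constant K with norm (A ** B) \<le>
  norm A * norm B * K, so the series is dominated by a multiple of the exponential series of norm A
  * K.\<close>

lemma summable_mat_exp: "summable (\<lambda>k. (1 / fact k) *\<^sub>R mpow (A :: 'n::finite cmat) k)"
proof -
  have "\<exists>K>0. \<forall>(A :: 'n cmat) (B :: 'n cmat). norm (A ** B) \<le> norm A * norm B * K"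
    by (rule mm.pos_bounded)
  then obtain K where K: "K > 0" "\<And>(A :: 'n cmat) (B :: 'n cmat). norm (A ** B) \<le> norm A * norm B * K"
    by blast
  have bound: "norm (mpow A k) \<le> norm (mat 1 :: 'n cmat) * (norm A * K) ^ k" for k
  proof (induction k)
    case (Suc k)
    have "norm (mpow A (Suc k)) \<le> norm A * K * norm (mpow A k)"
      using K(2) [of A "mpow A k"] by (simp add: mult.assoc mult.commute)
    also have "\<dots> \<le> norm A * K * (norm (mat 1 :: 'n cmat) * (norm A * K) ^ k)"
      using Suc K(1) by (intro mult_left_mono) auto
    finally show ?case by (simp add: ac_simps)
  qed simp
  have "summable (\<lambda>k. norm (mat 1 :: 'n cmat) * (inverse (fact k) * (norm A * K) ^ k))"
    by (intro summable_mult summable_exp)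
  then show ?thesis
    by (rule summable_comparison_test' [where N = 0])
      (use bound in \<open>simp add: field_simps\<close>)
qed

lemma mat_exp_sums: "(\<lambda>k. (1 / fact k) *\<^sub>R mpow A k) sums mat_exp A"
  using summable_mat_exp [of A] unfolding mat_exp_def mpow_def by (rule summable_sums)

lemma mat_exp_0: "mat_exp (0 :: 'n::finite cmat) = mat 1"
proof -
  have "(\<lambda>k. (1 / fact k) *\<^sub>R mpow (0 :: 'n cmat) k) = (\<lambda>k. if k = 0 then mat 1 else 0)"
    by (rule ext, case_tac k) (simp_all add: mm.zero_left)
  then show ?thesis
    using mat_exp_sums [of "0 :: 'n cmat"] sums_single [of 0 "\<lambda>_. mat 1 :: 'n cmat"]
    by (simp add: sums_unique2)
qed

text \<open>The relation passes to all powers by induction, and then to the series because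
  multiplication by g on either side is bounded linear.\<close>

lemma mat_exp_intertwine:
  fixes g :: "'n::finite cmat"
  assumes "g ** A = B ** g"
  shows "g ** mat_exp A = mat_exp B ** g"
proof -
  have "g ** mpow A k = mpow B k ** g" for k
  proof (induction k)
    case (Suc k)
    have "g ** mpow A (Suc k) = B ** (g ** mpow A k)"
      by (simp add: matrix_mul_assoc assms)
    then show ?case
      by (simp add: Suc matrix_mul_assoc)
  qed simp
  then have "(\<lambda>k. g ** ((1 / fact k) *\<^sub>R mpow A k)) = (\<lambda>k. ((1 / fact k) *\<^sub>R mpow B k) ** g)"
    by (simp add: mm.scaleR_left mm.scaleR_right)
  moreover have "(\<lambda>k. g ** ((1 / fact k) *\<^sub>R mpow A k)) sums (g ** mat_exp A)"
    by (rule bounded_linear.sums [OF mm.bounded_linear_right mat_exp_sums])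
  moreover have "(\<lambda>k. ((1 / fact k) *\<^sub>R mpow B k) ** g) sums (mat_exp B ** g)"
    by (rule bounded_linear.sums [OF mm.bounded_linear_left mat_exp_sums])
  ultimately show ?thesis
    by (simp add: sums_unique2)
qed

text \<open>
  This is \<open>exp E Z exp (- E) = exp (ad E) Z\<close> for \<open>ad E\<close> nilpotent on \<open>Z\<close>, multiplied by \<open>exp E\<close>
  on the right.
\<close>
lemma mat_exp_ad:
  fixes E Z :: "'n::finite cmat"
  assumes nil: "(lie_bracket E ^^ m) Z = 0"
  shows "mat_exp E ** Z = (\<Sum>j<m. (1 / fact j) *\<^sub>R (lie_bracket E ^^ j) Z) ** mat_exp E"
proof -
  define z where "z j = (lie_bracket E ^^ j) Z" for j
  have zm: "z j = 0" if "j \<ge> m" for j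
  proof -
    have "(lie_bracket E ^^ i) 0 = 0" for i
      by (induction i) (simp_all add: linear_0 linear_lie_bracket)
    then show ?thesis
      using that nil by (metis z_def le_add_diff_inverse2 comp_apply funpow_add)
  qed
  have Ez: "E ** z j = z (Suc j) + z j ** E" for j
    by (simp add: z_def lie_bracket_def)
  \<comment> \<open>\<open>c k j\<close> is the contribution of \<open>z j\<close> to the k-th term
    of \<open>mat_exp E ** Z\<close>. Summing first over j gives the left side of the claim, summing
    first over k the right side.\<close>
  define c where "c k j = (if j \<le> k then (1 / (fact j * fact (k - j))) *\<^sub>R (z j ** mpow E (k - j)) else 0)"
    for k j :: nat
  \<comment> \<open>Left multiplication by E is the sum of the commuting operators
    \<open>lie_bracket E\<close> and right multiplication by E; this is the binomial theorem for
    them, applied to Z.\<close>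
  have bin: "mpow E k ** Z = (\<Sum>j\<le>k. real (k choose j) *\<^sub>R (z j ** mpow E (k - j)))" for k
  proof (induction k)
    case 0
    show ?case by (simp add: z_def)
  next
    case (Suc k)
    let ?t = "\<lambda>j. z j ** mpow E (Suc k - j)"
    have "mpow E (Suc k) ** Z = E ** (mpow E k ** Z)"
      by (simp add: matrix_mul_assoc)
    also have "\<dots> = (\<Sum>j\<le>k. real (k choose j) *\<^sub>R (E ** z j ** mpow E (k - j)))"
      by (simp add: Suc mm.sum_right mm.scaleR_right matrix_mul_assoc)
    also have "\<dots> = (\<Sum>j\<le>k. real (k choose j) *\<^sub>R ?t (Suc j)) + (\<Sum>j\<le>k. real (k choose j) *\<^sub>R ?t j)"
      unfolding sum.distrib [symmetric]
    proof (intro sum.cong refl)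
      fix j assume "j \<in> {..k}"
      then have "mpow E (Suc k - j) = E ** mpow E (k - j)"
        by (simp add: Suc_diff_le)
      then show "real (k choose j) *\<^sub>R (E ** z j ** mpow E (k - j))
          = real (k choose j) *\<^sub>R ?t (Suc j) + real (k choose j) *\<^sub>R ?t j"
        by (simp add: Ez mm.add_left scaleR_add_right matrix_mul_assoc)
    qed
    also have "(\<Sum>j\<le>k. real (k choose j) *\<^sub>R ?t j)
        = ?t 0 + (\<Sum>j\<le>k. real (k choose Suc j) *\<^sub>R ?t (Suc j))"
    proof -
      have "(\<Sum>j\<le>k. real (k choose j) *\<^sub>R ?t j) = (\<Sum>j\<le>Suc k. real (k choose j) *\<^sub>R ?t j)"
        by (simp add: binomial_eq_0)
      also have "\<dots> = ?t 0 + (\<Sum>j\<le>k. real (k choose Suc j) *\<^sub>R ?t (Suc j))"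
        by (subst sum.atMost_Suc_shift) simp
      finally show ?thesis .
    qed
    also have "(\<Sum>j\<le>k. real (k choose j) *\<^sub>R ?t (Suc j))
        + (?t 0 + (\<Sum>j\<le>k. real (k choose Suc j) *\<^sub>R ?t (Suc j)))
        = ?t 0 + (\<Sum>j\<le>k. real (Suc k choose Suc j) *\<^sub>R ?t (Suc j))"
      by (simp add: sum.distrib scaleR_add_left algebra_simps)
    also have "\<dots> = (\<Sum>j\<le>Suc k. real (Suc k choose j) *\<^sub>R ?t j)"
      by (simp only: sum.atMost_Suc_shift [of "\<lambda>j. real (Suc k choose j) *\<^sub>R ?t j"]) simp
    finally show ?case .
  qed
  have "(1 / fact k) *\<^sub>R mpow E k ** Z = (\<Sum>j<m. c k j)" for k
  proof -
    have "(1 / fact k) *\<^sub>R mpow E k ** Z = (\<Sum>j\<le>k. c k j)"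
      by (simp add: bin mm.scaleR_left scaleR_sum_right c_def binomial_fact)
    also have "\<dots> = (\<Sum>j\<in>{..<max m (Suc k)}. c k j)"
      by (intro sum.mono_neutral_left) (auto simp: c_def)
    also have "\<dots> = (\<Sum>j<m. c k j)"
      by (intro sum.mono_neutral_right) (auto simp: c_def zm mm.zero_left)
    finally show ?thesis .
  qed
  then have L: "(\<lambda>k. \<Sum>j<m. c k j) sums (mat_exp E ** Z)"
    using bounded_linear.sums [OF mm.bounded_linear_left [of Z] mat_exp_sums [of E]]
    by simp
  \<comment> \<open>The terms with k < j vanish, so for fixed j this is the exponential series of E
    shifted by j.\<close>
  have "(\<lambda>k. c k j) sums ((1 / fact j) *\<^sub>R z j ** mat_exp E)" for j
  proof -
    have "(\<lambda>k. ((1 / fact j) *\<^sub>R z j) ** ((1 / fact k) *\<^sub>R mpow E k))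
        sums ((1 / fact j) *\<^sub>R z j ** mat_exp E)"
      by (rule bounded_linear.sums [OF mm.bounded_linear_right mat_exp_sums])
    then have "(\<lambda>k. c (k + j) j) sums ((1 / fact j) *\<^sub>R z j ** mat_exp E)"
      by (simp add: c_def mm.scaleR_left mm.scaleR_right mult.commute)
    moreover have "(\<Sum>k<j. c k j) = 0"
      by (simp add: c_def)
    ultimately show ?thesis
      using sums_iff_shift [of "\<lambda>k. c k j" j] by (metis add.right_neutral)
  qed
  then have "(\<lambda>k. \<Sum>j<m. c k j) sums (\<Sum>j<m. (1 / fact j) *\<^sub>R z j ** mat_exp E)"
    by (intro sums_sum)
  then have "mat_exp E ** Z = (\<Sum>j<m. (1 / fact j) *\<^sub>R z j ** mat_exp E)"
    using L sums_unique2 by blast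
  then show ?thesis
    by (simp add: z_def mm.sum_left)
qed

section \<open>Reflections and the general linear group\<close>

lemma coroot_uminus: "coroot (- \<alpha>) = - coroot \<alpha>"
  by (simp add: coroot_def)

lemma inner_coroot_self: "\<alpha> \<noteq> 0 \<Longrightarrow> \<alpha> \<bullet> coroot \<alpha> = 2"
  by (simp add: coroot_def)

lemma scaleR_coroot: "\<alpha> = (\<alpha> \<bullet> \<alpha> / 2) *\<^sub>R coroot \<alpha>"
  by (cases "\<alpha> = 0") (simp_all add: coroot_def)

lemma reflection_altdef: "reflection \<alpha> v = v - (\<alpha> \<bullet> v) *\<^sub>R coroot \<alpha>"
  by (simp add: reflection_def coroot_def inner_commute)

lemma linear_reflection: "linear (reflection \<alpha>)"
  by (rule linearI) (simp_all add: reflection_def inner_add_left algebra_simps)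

lemma reflection_self: "\<alpha> \<noteq> 0 \<Longrightarrow> reflection \<alpha> \<alpha> = - \<alpha>"
  by (simp add: reflection_def inner_coroot_self scaleR_2)

lemma inner_reflection: "\<alpha> \<noteq> 0 \<Longrightarrow> reflection \<alpha> u \<bullet> reflection \<alpha> v = u \<bullet> v"
  by (simp add: reflection_def coroot_def inner_diff_left inner_diff_right inner_commute field_simps)

lemma reflection_reflection: "\<alpha> \<noteq> 0 \<Longrightarrow> reflection \<alpha> (reflection \<alpha> v) = v"
  by (simp add: reflection_def coroot_def inner_diff_left field_simps)

lemma orthogonal_reflection: "\<alpha> \<noteq> 0 \<Longrightarrow> orthogonal_transformation (reflection \<alpha>)"
  by (simp add: orthogonal_transformation_def linear_reflection inner_reflection)

lemma coroot_orthogonal: "orthogonal_transformation v \<Longrightarrow> coroot (v \<alpha>) = v (coroot \<alpha>)"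
  by (simp add: coroot_def orthogonal_transformation_def linear_cmul)

lemma reflection_orthogonal:
  "orthogonal_transformation v \<Longrightarrow> reflection (v \<alpha>) (v x) = v (reflection \<alpha> x)"
  by (simp add: reflection_def coroot_orthogonal)
    (simp add: orthogonal_transformation_def linear_diff linear_cmul)

lemma matrix_inv_right: "invertible A \<Longrightarrow> A ** matrix_inv A = mat 1"
  and matrix_inv_left: "invertible A \<Longrightarrow> matrix_inv A ** A = mat 1"
  unfolding invertible_def matrix_inv_def by (metis (mono_tags, lifting) someI_ex)+

lemma matrix_inv_unique:
  fixes A :: "'a::semiring_1 ^ 'n ^ 'n::finite"
  assumes "A ** B = mat 1" "B ** A = mat 1"
  shows "matrix_inv A = B"
proof -
  have "invertible A"
    using assms invertible_def by blast
  then show ?thesis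
    by (metis assms(1) matrix_inv_left matrix_mul_assoc matrix_mul_lid matrix_mul_rid)
qed

lemma invertible_cancel [simp]:
  assumes "invertible g"
  shows "matrix_inv g ** (g ** A) = A" "g ** (matrix_inv g ** A) = A"
  by (simp_all add: matrix_mul_assoc matrix_inv_left matrix_inv_right assms)

lemma GL_simps [simp]:
  "carrier GL = {A. invertible A}" "x \<otimes>\<^bsub>GL\<^esub> y = x ** y" "\<one>\<^bsub>GL\<^esub> = mat 1"
  by (simp_all add: GL_def)

lemma invertible_matrix_inv: "invertible A \<Longrightarrow> invertible (matrix_inv A)"
  using invertible_def matrix_inv_left matrix_inv_right by blast

lemma group_GL: "group (GL :: 'n::finite cmat monoid)"
proof (rule groupI)
  fix x :: "'n cmat" assume "x \<in> carrier GL"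
  then show "\<exists>y\<in>carrier GL. y \<otimes>\<^bsub>GL\<^esub> x = \<one>\<^bsub>GL\<^esub>"
    by (intro bexI [of _ "matrix_inv x"]) (simp_all add: matrix_inv_left invertible_matrix_inv)
qed (simp_all add: invertible_mult matrix_mul_assoc invertible_def [of "mat 1 :: 'n cmat"])

interpretation GL: group "GL :: 'n::finite cmat monoid"
  by (rule group_GL)

lemma inv_GL [simp]: "invertible A \<Longrightarrow> inv\<^bsub>GL\<^esub> A = matrix_inv A"
  for A :: "'n::finite cmat"
  by (rule GL.inv_equality) (simp_all add: matrix_inv_left invertible_matrix_inv)

lemma matrix_inv_mult:
  fixes A B :: "'n::finite cmat"
  assumes "invertible A" "invertible B"
  shows "matrix_inv (A ** B) = matrix_inv B ** matrix_inv A"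
  using GL.inv_mult_group [of A B] assms by (simp add: invertible_mult)

lemma matrix_inv_mat_1: "matrix_inv (mat 1 :: 'n::finite cmat) = mat 1"
  by (rule matrix_inv_unique) simp_all

lemma matrix_inv_matrix_inv: "invertible A \<Longrightarrow> matrix_inv (matrix_inv A) = A"
  for A :: "'n::finite cmat"
  by (intro matrix_inv_unique matrix_inv_left matrix_inv_right)

lemma BijGroup_UNIV_simps:
  "carrier (BijGroup UNIV) = {f. bij f}"
  "bij f \<Longrightarrow> bij g \<Longrightarrow> f \<otimes>\<^bsub>BijGroup UNIV\<^esub> g = f \<circ> g"
  "\<one>\<^bsub>BijGroup UNIV\<^esub> = id"
  by (auto simp: BijGroup_def Bij_def compose_def fun_eq_iff)

section \<open>Special linear and unitary matrices\<close>

lemma unitri_mult: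
  "upper_unitri a ** upper_unitri b = upper_unitri (a + b)"
  "lower_unitri a ** lower_unitri b = lower_unitri (a + b)"
  by (simp_all add: upper_unitri_def lower_unitri_def vec_eq_iff forall_2
      matrix_matrix_mult_def sum_2 add.commute)

lemma unitri_0: "upper_unitri 0 = mat 1" "lower_unitri 0 = mat 1"
  by (simp_all add: upper_unitri_def lower_unitri_def vec_eq_iff forall_2 mat_def)

lemma det_unitri: "det (upper_unitri a) = 1" "det (lower_unitri a) = 1"
  by (simp_all add: upper_unitri_def lower_unitri_def det_2)

text \<open>Both sides are the matrix with rows (0, 1) and (-1, 0). Under
  \<open>sl2hom D \<alpha>\<close> they become two expressions for \<open>omega D \<alpha>\<close>,
  which \<open>sigma_omega\<close> compares.\<close>

lemma unitri_braid:
  "upper_unitri 1 ** lower_unitri (- 1) ** upper_unitri 1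
    = lower_unitri (- 1) ** upper_unitri 1 ** lower_unitri (- 1)"
  by (simp add: upper_unitri_def lower_unitri_def vec_eq_iff forall_2
      matrix_matrix_mult_def sum_2)

lemma SL2_simps [simp]:
  "carrier SL2 = {A. det A = 1}" "x \<otimes>\<^bsub>SL2\<^esub> y = x ** y" "\<one>\<^bsub>SL2\<^esub> = mat 1"
  by (simp_all add: SL2_def)

lemma sl2_factorization:
  fixes A :: "2 cmat"
  assumes "det A = 1" "A $ 2 $ 1 \<noteq> 0"
  shows "A = upper_unitri ((A $ 1 $ 1 - 1) / A $ 2 $ 1) ** lower_unitri (A $ 2 $ 1)
    ** upper_unitri ((A $ 2 $ 2 - 1) / A $ 2 $ 1)"
  using assms
  by (simp add: det_2 vec_eq_iff forall_2 upper_unitri_def lower_unitri_def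
      matrix_matrix_mult_def sum_2 field_simps)

text \<open>Unitriangular matrices generate SL2. If the lower left entry is nonzero, the explicit
  factorization applies; otherwise right multiplication by \<open>lower_unitri 1\<close> turns that
  entry into the diagonal entry at (2, 2), which is nonzero as the determinant is 1.\<close>

lemma sl2_induct [consumes 1, case_names upper lower mult]:
  fixes A :: "2 cmat"
  assumes "det A = 1" "\<And>t. P (upper_unitri t)" "\<And>t. P (lower_unitri t)"
    and mult: "\<And>A B. \<lbrakk>det A = 1; det B = 1; P A; P B\<rbrakk> \<Longrightarrow> P (A ** B)"
  shows "P A"
proof -
  have nz: "P A" if "det A = 1" "A $ 2 $ 1 \<noteq> 0" for A
    by (subst sl2_factorization [OF that]) (intro mult assms; simp add: det_mul det_unitri)
  show ?thesis
  proof (cases "A $ 2 $ 1 = 0")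
    case True
    have "det (A ** lower_unitri 1) = 1"
      by (simp add: det_mul det_unitri assms(1))
    moreover have "(A ** lower_unitri 1) $ 2 $ 1 \<noteq> 0"
      using assms(1) True by (auto simp: lower_unitri_def matrix_matrix_mult_def sum_2 det_2)
    ultimately have "P (A ** lower_unitri 1 ** lower_unitri (- 1))"
      by (intro mult nz assms(3)) (simp_all add: det_unitri)
    then show ?thesis
      by (simp add: unitri_mult unitri_0 flip: matrix_mul_assoc)
  qed (use nz assms in blast)
qed

text \<open>Conjugation by the diagonal matrix with entries \<open>a\<close>, \<open>1\<close>.\<close>
definition twist :: "complex \<Rightarrow> 2 cmat \<Rightarrow> 2 cmat" where
  "twist a A = vector [vector [A $ 1 $ 1, a * A $ 1 $ 2], vector [inverse a * A $ 2 $ 1, A $ 2 $ 2]]"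

lemma twist_upper: "twist a (upper_unitri t) = upper_unitri (a * t)"
  and twist_lower: "twist a (lower_unitri t) = lower_unitri (inverse a * t)"
  by (simp_all add: twist_def upper_unitri_def lower_unitri_def)

lemma twist_mult: "a \<noteq> 0 \<Longrightarrow> twist a (A ** B) = twist a A ** twist a B"
  by (simp add: twist_def vec_eq_iff forall_2 matrix_matrix_mult_def sum_2 field_simps)

lemma det_twist: "a \<noteq> 0 \<Longrightarrow> det (twist a A) = det A"
  by (simp add: twist_def det_2)

text \<open>For a unit scalar a the inverse is the conjugate, so the twist is conjugation by a
  unitary diagonal matrix.\<close>

lemma twist_SU2:
  assumes "cmod a = 1" "A \<in> SU2"
  shows "twist a A \<in> SU2"
proof -
  have aa: "a * cnj a = 1"
    using assms(1) complex_norm_square [of a] by simp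
  have a: "a \<noteq> 0" "inverse a = cnj a"
    using assms(1) inverse_unique [OF aa] by auto
  have "det A = 1" and AA: "A ** transpose (map_matrix cnj A) = mat 1"
    using assms(2) by (auto simp: SU2_def)
  define p q r s where "p = A $ 1 $ 1" and "q = A $ 1 $ 2" and "r = A $ 2 $ 1" and "s = A $ 2 $ 2"
  note defs = p_def q_def r_def s_def
  have A: "p * cnj p + q * cnj q = 1" "p * cnj r + q * cnj s = 0"
      "r * cnj p + s * cnj q = 0" "r * cnj r + s * cnj s = 1"
    using AA by (simp_all add: defs vec_eq_iff forall_2 matrix_matrix_mult_def sum_2 transpose_def
        map_matrix_def mat_def)
  have "p * cnj p + (a * q) * (cnj a * cnj q) = p * cnj p + (a * cnj a) * (q * cnj q)"
    by (simp only: ac_simps)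
  moreover have "(cnj a * r) * (a * cnj r) + s * cnj s = (a * cnj a) * (r * cnj r) + s * cnj s"
    by (simp only: ac_simps)
  moreover have "p * (a * cnj r) + (a * q) * cnj s = a * (p * cnj r + q * cnj s)"
    "(cnj a * r) * cnj p + s * (cnj a * cnj q) = cnj a * (r * cnj p + s * cnj q)"
    by (simp_all only: distrib_left ac_simps)
  ultimately have T: "p * cnj p + (a * q) * (cnj a * cnj q) = 1"
      "p * (a * cnj r) + (a * q) * cnj s = 0" "(cnj a * r) * cnj p + s * (cnj a * cnj q) = 0"
      "(cnj a * r) * (a * cnj r) + s * cnj s = 1"
    by (simp_all only: aa mult_1_left A mult_zero_right)
  have "twist a A ** transpose (map_matrix cnj (twist a A)) = mat 1"
    using T by (simp add: twist_def vec_eq_iff forall_2 matrix_matrix_mult_def sum_2 transpose_def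
        map_matrix_def mat_def a(2) flip: defs)
  then show ?thesis
    using \<open>det A = 1\<close> a(1) by (simp add: SU2_def det_twist)
qed

lemma unitri_braid_SU2: "upper_unitri 1 ** lower_unitri (- 1) ** upper_unitri 1 \<in> SU2"
proof -
  have "upper_unitri 1 ** lower_unitri (- 1) ** upper_unitri 1 = vector [vector [0, 1], vector [- 1, 0]]"
    by (simp add: upper_unitri_def lower_unitri_def vec_eq_iff forall_2 matrix_matrix_mult_def sum_2)
  then show ?thesis
    by (simp add: SU2_def det_2 vec_eq_iff forall_2 matrix_matrix_mult_def sum_2 transpose_def
        map_matrix_def mat_def)
qed

lemma SU2_mult:
  assumes "A \<in> SU2" "B \<in> SU2"
  shows "A ** B \<in> SU2"
proof -
  have "map_matrix cnj (A ** B) = map_matrix cnj A ** map_matrix cnj B"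
    by (simp add: map_matrix_def matrix_matrix_mult_def vec_eq_iff)
  then have "A ** B ** transpose (map_matrix cnj (A ** B))
      = A ** (B ** transpose (map_matrix cnj B)) ** transpose (map_matrix cnj A)"
    by (simp add: matrix_transpose_mul matrix_mul_assoc)
  with assms show ?thesis
    by (simp add: SU2_def det_mul)
qed

section \<open>Root elements and the Lie algebra\<close>

text \<open>
  \<open>H\<close> and \<open>\<iota>\<close> are the witnesses of the existential quantifiers in
  \<^const>\<open>chevalley_basis\<close> and \<^const>\<open>compact_chevalley\<close>.
\<close>
locale compact_chev =
  fixes D :: "('e::euclidean_space, 'n::finite) chev"
    and H :: "'e \<Rightarrow> 'n cmat"
    and \<iota> :: "('e \<Rightarrow> 'e) \<Rightarrow> 'n cmat set"
  assumes chevalley: "compact_chevalley D"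
    and linear_H: "linear H"
    and X_neg: "\<And>\<alpha>. \<alpha> \<in> roots D \<Longrightarrow> lie_bracket (root_vec D \<alpha>) (root_vec D (- \<alpha>)) = H (coroot \<alpha>)"
    and H_H: "\<And>\<alpha> \<beta>. \<lbrakk>\<alpha> \<in> roots D; \<beta> \<in> roots D\<rbrakk> \<Longrightarrow> lie_bracket (H (coroot \<alpha>)) (H (coroot \<beta>)) = 0"
    and H_X: "\<And>\<alpha> \<beta>. \<lbrakk>\<alpha> \<in> roots D; \<beta> \<in> roots D\<rbrakk> \<Longrightarrow>
      lie_bracket (H (coroot \<alpha>)) (root_vec D \<beta>) = mat (of_real (\<beta> \<bullet> coroot \<alpha>)) ** root_vec D \<beta>"
    and indep: "\<And>a b. (\<Sum>\<alpha>\<in>roots D. mat (a \<alpha>) ** root_vec D \<alpha>)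
        + (\<Sum>\<alpha>\<in>simple_roots D. mat (b \<alpha>) ** H (coroot \<alpha>)) = 0
      \<Longrightarrow> (\<forall>\<alpha>\<in>roots D. a \<alpha> = 0) \<and> (\<forall>\<alpha>\<in>simple_roots D. b \<alpha> = 0)"
    and iota_iso: "\<iota> \<in> iso (weyl D) (Nrm D Mod compact_torus D)"
    and iota_reflection: "\<And>\<alpha>. \<alpha> \<in> roots D \<Longrightarrow> \<iota> (reflection \<alpha>) = omega D \<alpha> <#\<^bsub>GL\<^esub> compact_torus D"
    and rep_in_iota: "\<And>w. w \<in> carrier (weyl D) \<Longrightarrow> rep D w \<in> \<iota> w"
begin

abbreviation \<Phi> where "\<Phi> \<equiv> roots D"
abbreviation \<Delta> where "\<Delta> \<equiv> simple_roots D"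
abbreviation X where "X \<equiv> root_vec D"
abbreviation x where "x \<equiv> root_elt D"
abbreviation K where "K \<equiv> compact_torus D"

section \<open>Roots and bracket relations\<close>

lemma finite_roots: "finite \<Phi>"
  and zero_not_root: "0 \<notin> \<Phi>"
  and reflection_image: "\<alpha> \<in> \<Phi> \<Longrightarrow> reflection \<alpha> ` \<Phi> = \<Phi>"
  and scaled_root: "\<alpha> \<in> \<Phi> \<Longrightarrow> c *\<^sub>R \<alpha> \<in> \<Phi> \<Longrightarrow> c = 1 \<or> c = -1"
  using chevalley by (auto simp: compact_chevalley_def root_system_def)

lemma root_nz: "\<alpha> \<in> \<Phi> \<Longrightarrow> \<alpha> \<noteq> 0"
  using zero_not_root by auto

lemma reflection_root: "\<alpha> \<in> \<Phi> \<Longrightarrow> \<beta> \<in> \<Phi> \<Longrightarrow> reflection \<alpha> \<beta> \<in> \<Phi>"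
  using reflection_image by blast

lemma uminus_root: "\<alpha> \<in> \<Phi> \<Longrightarrow> - \<alpha> \<in> \<Phi>"
  by (metis reflection_root reflection_self root_nz)

lemma simple_roots_subset: "\<Delta> \<subseteq> \<Phi>"
  and root_in_span_simple: "\<beta> \<in> \<Phi> \<Longrightarrow> \<beta> \<in> span \<Delta>"
proof -
  show "\<Delta> \<subseteq> \<Phi>"
    using chevalley by (simp add: compact_chevalley_def root_base_def)
  show "\<beta> \<in> span \<Delta>" if "\<beta> \<in> \<Phi>"
  proof -
    obtain c :: "'e \<Rightarrow> int" where "\<beta> = (\<Sum>\<alpha>\<in>\<Delta>. of_int (c \<alpha>) *\<^sub>R \<alpha>)"
      using chevalley \<open>\<beta> \<in> \<Phi>\<close> by (auto simp: compact_chevalley_def root_base_def)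
    then show ?thesis
      by (simp add: span_sum span_scale span_base)
  qed
qed

lemma finite_simple_roots: "finite \<Delta>"
  using finite_roots simple_roots_subset finite_subset by blast

lemma X_sum_bracket:
  assumes "\<alpha> \<in> \<Phi>" "\<beta> \<in> \<Phi>" "\<alpha> + \<beta> \<in> \<Phi>"
  shows "\<exists>d. lie_bracket (X \<alpha>) (X \<beta>) = mat d ** X (\<alpha> + \<beta>)"
proof -
  have "chevalley_basis \<Phi> \<Delta> X"
    using chevalley by (simp add: compact_chevalley_def)
  then obtain N where "\<forall>\<alpha>\<in>\<Phi>. \<forall>\<beta>\<in>\<Phi>. \<alpha> + \<beta> \<in> \<Phi> \<longrightarrow>
      lie_bracket (X \<alpha>) (X \<beta>) = mat (N \<alpha> \<beta>) ** X (\<alpha> + \<beta>) \<and> N (- \<alpha>) (- \<beta>) = - N \<alpha> \<beta>"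
    unfolding chevalley_basis_def by (elim conjE exE)
  with assms show ?thesis
    by blast
qed

lemma X_commute:
  assumes "\<alpha> \<in> \<Phi>" "\<beta> \<in> \<Phi>" "\<alpha> + \<beta> \<notin> \<Phi>" "\<alpha> + \<beta> \<noteq> 0"
  shows "lie_bracket (X \<alpha>) (X \<beta>) = 0"
proof -
  have "chevalley_basis \<Phi> \<Delta> X"
    using chevalley by (simp add: compact_chevalley_def)
  then have "\<forall>\<alpha>\<in>\<Phi>. \<forall>\<beta>\<in>\<Phi>. \<alpha> + \<beta> \<notin> \<Phi> \<and> \<alpha> + \<beta> \<noteq> 0 \<longrightarrow> lie_bracket (X \<alpha>) (X \<beta>) = 0"
    unfolding chevalley_basis_def by (elim conjE)
  with assms show ?thesis
    by blast
qed

lemma X_nz: "\<alpha> \<in> \<Phi> \<Longrightarrow> X \<alpha> \<noteq> 0"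
proof
  assume "\<alpha> \<in> \<Phi>" "X \<alpha> = 0"
  then have "(\<Sum>\<beta>\<in>\<Phi>. mat (if \<beta> = \<alpha> then 1 else 0) ** X \<beta>) = 0"
    by (intro sum.neutral) (auto simp: mm.zero_left)
  then show False
    using indep [of "\<lambda>\<beta>. if \<beta> = \<alpha> then 1 else 0" "\<lambda>_. 0"] \<open>\<alpha> \<in> \<Phi>\<close>
    by (auto simp: mm.zero_left)
qed

text \<open>Every root is a real multiple of its coroot, so the relation \<open>H_X\<close> for
  coroots extends by linearity. The extension is what allows h to be moved by reflections.\<close>

lemma H_X_span:
  assumes "h \<in> span \<Phi>" "\<beta> \<in> \<Phi>"
  shows "lie_bracket (H h) (X \<beta>) = (\<beta> \<bullet> h) *\<^sub>R X \<beta>"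
  using assms(1)
proof (induction h rule: span_induct_alt)
  case base
  show ?case
    by (simp add: linear_0 [OF linear_H] lie_bracket_def mm.zero_left mm.zero_right)
next
  case (step c \<alpha> h)
  have "lie_bracket (H (\<alpha>)) (X \<beta>) = (\<beta> \<bullet> \<alpha>) *\<^sub>R X \<beta>"
  proof -
    have "H \<alpha> = (\<alpha> \<bullet> \<alpha> / 2) *\<^sub>R H (coroot \<alpha>)"
      by (metis linear_H linear_cmul scaleR_coroot)
    then have "lie_bracket (H \<alpha>) (X \<beta>) = (\<alpha> \<bullet> \<alpha> / 2) *\<^sub>R lie_bracket (H (coroot \<alpha>)) (X \<beta>)"
      by (simp add: lie_bracket_def mm.scaleR_left mm.scaleR_right scaleR_diff_right)
    also have "\<dots> = (\<beta> \<bullet> ((\<alpha> \<bullet> \<alpha> / 2) *\<^sub>R coroot \<alpha>)) *\<^sub>R X \<beta>"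
      using step(1) assms(2) by (simp add: H_X mat_of_real_mult)
    finally show ?thesis
      by (simp flip: scaleR_coroot)
  qed
  moreover have "lie_bracket (H (c *\<^sub>R \<alpha> + h)) (X \<beta>)
      = c *\<^sub>R lie_bracket (H \<alpha>) (X \<beta>) + lie_bracket (H h) (X \<beta>)"
    by (simp add: linear_add [OF linear_H] linear_cmul [OF linear_H] lie_bracket_def mm.add_left
        mm.add_right mm.scaleR_left mm.scaleR_right scaleR_diff_right)
  ultimately show ?case
    using step by (simp add: inner_add_right scaleR_add_left)
qed

lemma coroot_in_span: "\<alpha> \<in> \<Phi> \<Longrightarrow> coroot \<alpha> \<in> span \<Phi>"
  by (simp add: coroot_def span_scale span_base)

lemma reflection_in_span: "\<alpha> \<in> \<Phi> \<Longrightarrow> h \<in> span \<Phi> \<Longrightarrow> reflection \<alpha> h \<in> span \<Phi>"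
  by (simp add: reflection_def span_diff span_scale span_base)

text \<open>Its bracket with \<open>X \<alpha>\<close> is 2 times \<open>X \<alpha>\<close>, which
  is nonzero.\<close>

lemma H_coroot_nz: "\<alpha> \<in> \<Phi> \<Longrightarrow> H (coroot \<alpha>) \<noteq> 0"
  using H_X_span [OF coroot_in_span, of \<alpha> \<alpha>] X_nz [of \<alpha>] inner_coroot_self [OF root_nz, of \<alpha>]
  by (auto simp: lie_bracket_def mm.zero_left mm.zero_right)

section \<open>Root elements and their adjoint action in rank one\<close>

lemma sl2hom_upper: "\<alpha> \<in> \<Phi> \<Longrightarrow> sl2hom D \<alpha> (upper_unitri t) = x \<alpha> t"
  and sl2hom_lower: "\<alpha> \<in> \<Phi> \<Longrightarrow> sl2hom D \<alpha> (lower_unitri t) = x (- \<alpha>) t"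
  and sl2hom_mult: "\<alpha> \<in> \<Phi> \<Longrightarrow> det A = 1 \<Longrightarrow> det B = 1 \<Longrightarrow>
    sl2hom D \<alpha> (A ** B) = sl2hom D \<alpha> A ** sl2hom D \<alpha> B"
  using chevalley by (auto simp: compact_chevalley_def hom_def chev_group_def)

lemma x_0: "x \<alpha> 0 = mat 1"
  by (simp add: root_elt_def mm.zero_left mat_exp_0)

lemma x_add: "\<alpha> \<in> \<Phi> \<Longrightarrow> x \<alpha> s ** x \<alpha> t = x \<alpha> (s + t)"
  by (metis sl2hom_upper sl2hom_mult unitri_mult(1) det_unitri(1))

lemma x_uminus: "\<alpha> \<in> \<Phi> \<Longrightarrow> x \<alpha> t ** x \<alpha> (- t) = mat 1" "\<alpha> \<in> \<Phi> \<Longrightarrow> x \<alpha> (- t) ** x \<alpha> t = mat 1"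
  by (simp_all add: x_add x_0)

lemma invertible_x: "\<alpha> \<in> \<Phi> \<Longrightarrow> invertible (x \<alpha> t)"
  unfolding invertible_def using x_uminus by blast

lemma invertible_w_elt: "\<alpha> \<in> \<Phi> \<Longrightarrow> invertible (w_elt D \<alpha> t)"
  by (simp add: w_elt_def invertible_mult invertible_x uminus_root)

text \<open>The bracket of t \<open>X \<beta>\<close> with \<open>H h\<close> is a multiple of
  \<open>X \<beta>\<close>, whose next bracket vanishes; hence exp (ad) stops after the linear
  term.\<close>

lemma x_H:
  assumes "\<beta> \<in> \<Phi>" "h \<in> span \<Phi>"
  shows "x \<beta> t ** H h = (H h - mat (t * of_real (\<beta> \<bullet> h)) ** X \<beta>) ** x \<beta> t"
proof -
  let ?E = "mat t ** X \<beta>"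
  have 1: "lie_bracket ?E (H h) = - (mat (t * of_real (\<beta> \<bullet> h)) ** X \<beta>)"
    by (simp add: lie_bracket_mat lie_bracket_skew [of "X \<beta>" "H h"] H_X_span assms mm.minus_right
        mat_of_real_mult flip: mat_mult_mat)
  have "lie_bracket ?E (X \<beta>) = 0"
    by (simp add: lie_bracket_mat) (simp add: lie_bracket_def mm.zero_right)
  then have "lie_bracket ?E (- (mat c ** X \<beta>)) = 0" for c
    by (metis lie_bracket_mat(1) linear_lie_bracket linear_neg mm.zero_right neg_equal_0_iff_equal)
  then have "(lie_bracket ?E ^^ 2) (H h) = 0"
    by (simp add: 1 numeral_2_eq_2)
  from mat_exp_ad [OF this] show ?thesis
    by (simp add: root_elt_def numeral_2_eq_2 1)
qed

lemma x_X: "x \<beta> t ** X \<beta> = X \<beta> ** x \<beta> t"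
proof -
  have "lie_bracket (mat t ** X \<beta>) (X \<beta>) = 0"
    by (simp add: lie_bracket_mat) (simp add: lie_bracket_def mm.zero_right)
  then have "(lie_bracket (mat t ** X \<beta>) ^^ 1) (X \<beta>) = 0"
    by simp
  from mat_exp_ad [OF this] show ?thesis
    by (simp add: root_elt_def)
qed

text \<open>Iterated brackets with t \<open>X \<beta>\<close> lead from \<open>X (- \<beta>)\<close>
  to \<open>H (coroot \<beta>)\<close>, then to \<open>X \<beta>\<close>, then to 0. In the
  quadratic term the pairing of \<beta> with its coroot, which is 2, cancels the factor 1/2.\<close>

lemma x_X_neg:
  assumes "\<beta> \<in> \<Phi>"
  shows "x \<beta> t ** X (- \<beta>)
    = (X (- \<beta>) + mat t ** H (coroot \<beta>) - mat (t * t) ** X \<beta>) ** x \<beta> t"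
proof -
  let ?E = "mat t ** X \<beta>"
  have 1: "lie_bracket ?E (X (- \<beta>)) = mat t ** H (coroot \<beta>)"
    by (simp add: lie_bracket_mat X_neg assms)
  have 2: "lie_bracket ?E (mat t ** H (coroot \<beta>)) = - (2 *\<^sub>R (mat (t * t) ** X \<beta>))"
    using assms by (simp add: lie_bracket_mat lie_bracket_skew [of "X \<beta>" "H _"] H_X_span
        coroot_in_span inner_coroot_self root_nz mm.minus_right mm.scaleR_right mat_mult_mat)
  have "lie_bracket ?E (X \<beta>) = 0"
    by (simp add: lie_bracket_mat) (simp add: lie_bracket_def mm.zero_right)
  then have 3: "lie_bracket ?E (- (2 *\<^sub>R (mat c ** X \<beta>))) = 0" for c
    by (simp add: linear_neg [OF linear_lie_bracket] linear_cmul [OF linear_lie_bracket]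
        lie_bracket_mat(1) mm.zero_right)
  have "(lie_bracket ?E ^^ 3) (X (- \<beta>)) = 0"
    by (simp add: 1 2 3 numeral_3_eq_3)
  from mat_exp_ad [OF this] show ?thesis
    by (simp add: root_elt_def numeral_3_eq_3 1 2)
qed

text \<open>\<open>H h\<close> is pushed through the three factors e, f, e. The first e adds a
  multiple of \<open>X \<beta>\<close>; passing f makes the \<open>X (- \<beta>)\<close> terms
  cancel and turns h into its reflection; since \<beta> pairs with the reflection to - b, the last e
  removes the \<open>X \<beta>\<close> term.\<close>

lemma w_elt_H:
  assumes "\<beta> \<in> \<Phi>" "h \<in> span \<Phi>" "t \<noteq> 0"
  shows "w_elt D \<beta> t ** H h = H (reflection \<beta> h) ** w_elt D \<beta> t"
proof -
  define b where "b = \<beta> \<bullet> h"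
  define e where "e = x \<beta> t"
  define f where "f = x (- \<beta>) (- inverse t)"
  have Hs: "H (reflection \<beta> h) = H h - mat (of_real b) ** H (coroot \<beta>)"
    by (simp add: reflection_altdef b_def linear_diff [OF linear_H] linear_cmul [OF linear_H]
        mat_of_real_mult)
  have bs: "\<beta> \<bullet> reflection \<beta> h = - b"
    using inner_reflection [OF root_nz, of \<beta> \<beta> h] reflection_self [OF root_nz, of \<beta>] assms
    by (simp add: b_def)
  have 1: "e ** H h = (H h - mat (t * of_real b) ** X \<beta>) ** e"
    using x_H [OF assms(1,2)] by (simp add: b_def e_def)
  have 2: "f ** H h = (H h - mat (inverse t * of_real b) ** X (- \<beta>)) ** f"
    using x_H [OF uminus_root [OF assms(1)] assms(2)] by (simp add: b_def f_def)
  have 3: "f ** X \<beta> = (X \<beta> + mat (inverse t) ** H (coroot \<beta>) - mat (inverse t * inverse t) ** X (- \<beta>)) ** f"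
  proof -
    have "mat (- inverse t) ** (- H (coroot \<beta>)) = mat (inverse t) ** H (coroot \<beta>)"
      by (simp add: vec_eq_iff)
    then show ?thesis
      using x_X_neg [OF uminus_root [OF assms(1)], of "- inverse t"]
      by (simp add: f_def coroot_uminus linear_neg [OF linear_H])
  qed
  have 4: "e ** H (reflection \<beta> h) = (H (reflection \<beta> h) + mat (t * of_real b) ** X \<beta>) ** e"
  proof -
    have "H (reflection \<beta> h) - mat (t * of_real (- b)) ** X \<beta>
        = H (reflection \<beta> h) + mat (t * of_real b) ** X \<beta>"
      by (simp add: vec_eq_iff)
    then show ?thesis
      using x_H [OF assms(1) reflection_in_span [OF assms(1,2)], of t] by (simp only: bs e_def)
  qed
  have 5: "e ** X \<beta> = X \<beta> ** e"
    by (simp add: e_def x_X)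
  have "f ** (H h - mat (t * of_real b) ** X \<beta>) = (H (reflection \<beta> h) - mat (t * of_real b) ** X \<beta>) ** f"
  proof -
    have "f ** (H h - mat (t * of_real b) ** X \<beta>) = f ** H h - mat (t * of_real b) ** (f ** X \<beta>)"
      by (simp add: mm.diff_right mat_left_comm)
    also have "\<dots> = ((H h - mat (inverse t * of_real b) ** X (- \<beta>))
        - mat (t * of_real b) ** (X \<beta> + mat (inverse t) ** H (coroot \<beta>) - mat (inverse t * inverse t) ** X (- \<beta>))) ** f"
    proof -
      have "A ** f - m ** (B ** f) = (A - m ** B) ** f" for A B m :: "'n cmat"
        by (simp add: mm.diff_left matrix_mul_assoc)
      then show ?thesis
        unfolding 2 3 .
    qed
    also have "(H h - mat (inverse t * of_real b) ** X (- \<beta>))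
        - mat (t * of_real b) ** (X \<beta> + mat (inverse t) ** H (coroot \<beta>) - mat (inverse t * inverse t) ** X (- \<beta>))
        = H (reflection \<beta> h) - mat (t * of_real b) ** X \<beta>"
      using \<open>t \<noteq> 0\<close> by (simp add: Hs vec_eq_iff field_simps)
    finally show ?thesis .
  qed
  moreover have "e ** (H (reflection \<beta> h) - mat (t * of_real b) ** X \<beta>) = H (reflection \<beta> h) ** e"
    by (simp add: mm.diff_right mat_left_comm 4 5 mm.add_left) (simp add: matrix_mul_assoc)
  ultimately have "e ** f ** e ** H h = H (reflection \<beta> h) ** (e ** f ** e)"
    by (metis 1 matrix_mul_assoc)
  then show ?thesis
    by (simp add: w_elt_def e_def f_def)
qed


text \<open>The real span of the following set is the complex Lie algebra of \<open>G\<close>.\<close>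
definition gens :: "'n cmat set" where
  "gens = {mat c ** X \<alpha> | c \<alpha>. \<alpha> \<in> \<Phi>} \<union> {mat c ** H h | c h. h \<in> span \<Phi>}"

lemma X_in_gens: "\<alpha> \<in> \<Phi> \<Longrightarrow> mat c ** X \<alpha> \<in> gens"
  and H_in_gens: "h \<in> span \<Phi> \<Longrightarrow> mat c ** H h \<in> gens"
  unfolding gens_def by blast+

lemma zero_in_gens: "0 \<in> gens"
  using H_in_gens [of 0 0] by (simp add: span_zero mm.zero_left)

text \<open>This keeps all iterated brackets in exp (ad) inside \<open>gens\<close>. For \<alpha> =
  - \<beta> the bracket falls into the Cartan part, otherwise it is a root vector multiple or
  zero.\<close>

lemma ad_gens:
  assumes "\<beta> \<in> \<Phi>" "Z \<in> gens"
  shows "lie_bracket (mat t ** X \<beta>) Z \<in> gens"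
  using assms(2) unfolding gens_def
proof (elim UnE CollectE exE conjE)
  fix c \<alpha> assume Z: "Z = mat c ** X \<alpha>" "\<alpha> \<in> \<Phi>"
  have br: "lie_bracket (mat t ** X \<beta>) Z = mat (c * t) ** lie_bracket (X \<beta>) (X \<alpha>)"
    by (simp add: Z lie_bracket_mat mat_mult_mat)
  consider "\<beta> + \<alpha> \<in> \<Phi>" | "\<alpha> = - \<beta>" | "\<beta> + \<alpha> \<notin> \<Phi>" "\<beta> + \<alpha> \<noteq> 0"
    by (metis add_eq_0_iff)
  then show "lie_bracket (mat t ** X \<beta>) Z \<in> {mat c ** X \<alpha> | c \<alpha>. \<alpha> \<in> \<Phi>} \<union> {mat c ** H h | c h. h \<in> span \<Phi>}"
  proof cases
    case 1
    then show ?thesis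
      using X_sum_bracket [OF assms(1) Z(2)] X_in_gens [OF 1]
      by (auto simp: br mat_mult_mat simp flip: gens_def)
  next
    case 2
    then show ?thesis
      using assms(1) H_in_gens coroot_in_span by (simp add: br X_neg flip: gens_def)
  next
    case 3
    then show ?thesis
      unfolding br X_commute [OF assms(1) Z(2) 3] using zero_in_gens
      by (simp add: mm.zero_right flip: gens_def)
  qed
next
  fix c h assume Z: "Z = mat c ** H h" "h \<in> span \<Phi>"
  have "lie_bracket (mat t ** X \<beta>) Z = mat (c * t) ** lie_bracket (X \<beta>) (H h)"
    by (simp add: Z lie_bracket_mat mat_mult_mat)
  also have "lie_bracket (X \<beta>) (H h) = mat (of_real (- (\<beta> \<bullet> h))) ** X \<beta>"
    by (simp only: lie_bracket_skew [of "X \<beta>"] H_X_span [OF Z(2) assms(1)] mat_of_real_mult scaleR_minus_left)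
  also have "mat (c * t) ** \<dots> = mat (c * t * of_real (- (\<beta> \<bullet> h))) ** X \<beta>"
    by (rule mat_mult_mat)
  finally show "lie_bracket (mat t ** X \<beta>) Z \<in> {mat c ** X \<alpha> | c \<alpha>. \<alpha> \<in> \<Phi>} \<union> {mat c ** H h | c h. h \<in> span \<Phi>}"
    using X_in_gens [OF assms(1)] by (simp only: flip: gens_def)
qed

lemma ad_X_self: "lie_bracket (mat t ** X \<beta>) (mat c ** X \<beta>) = 0"
  by (simp add: lie_bracket_mat) (simp add: lie_bracket_def mm.zero_right)

text \<open>Along the \<beta>-string through \<alpha>, the j-th iterated bracket is either 0 or a
  multiple of \<open>X (\<alpha> + j \<beta>)\<close> with \<alpha> + j \<beta> a root. Finiteness
  of the root system forces it to become 0. The string through - \<beta> passes through the Cartan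
  part and is treated separately.\<close>

lemma ad_nilpotent:
  assumes "\<beta> \<in> \<Phi>" "Z \<in> gens"
  shows "\<exists>m. (lie_bracket (mat t ** X \<beta>) ^^ m) Z = 0"
proof -
  let ?ad = "lie_bracket (mat t ** X \<beta>)"
  have H: "(?ad ^^ 2) (mat c ** H h) = 0" if "h \<in> span \<Phi>" for c h
  proof -
    have "?ad (mat c ** H h) = mat (c * t) ** lie_bracket (X \<beta>) (H h)"
      by (simp add: lie_bracket_mat mat_mult_mat)
    also have "lie_bracket (X \<beta>) (H h) = mat (of_real (- (\<beta> \<bullet> h))) ** X \<beta>"
      by (simp only: lie_bracket_skew [of "X \<beta>"] H_X_span [OF that assms(1)] mat_of_real_mult scaleR_minus_left)
    finally have "?ad (mat c ** H h) = mat (c * t * of_real (- (\<beta> \<bullet> h))) ** X \<beta>"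
      by (simp only: mat_mult_mat)
    then show ?thesis
      by (simp add: numeral_2_eq_2 ad_X_self)
  qed
  show ?thesis
    using assms(2) unfolding gens_def
  proof (elim UnE CollectE exE conjE)
    fix c \<alpha> assume Z: "Z = mat c ** X \<alpha>" "\<alpha> \<in> \<Phi>"
    show ?thesis
    proof (cases "\<alpha> = - \<beta>")
      case True
      have "?ad Z = mat (c * t) ** H (coroot \<beta>)"
        by (simp add: Z lie_bracket_mat mat_mult_mat True X_neg assms)
      then have "(?ad ^^ 2) (?ad Z) = 0"
        using H coroot_in_span assms by simp
      then show ?thesis
        by (intro exI [of _ 3]) (simp add: numeral_3_eq_3 numeral_2_eq_2)
    next
      case False
      have string: "(?ad ^^ j) Z = 0 \<or>
        (\<alpha> + real j *\<^sub>R \<beta> \<in> \<Phi> \<and> (\<exists>d. (?ad ^^ j) Z = mat d ** X (\<alpha> + real j *\<^sub>R \<beta>)))" for j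
      proof (induction j)
        case 0
        then show ?case using Z by auto
      next
        case (Suc j)
        show ?case
        proof (cases "(?ad ^^ j) Z = 0")
          case True
          then show ?thesis
            by (simp add: linear_0 linear_lie_bracket)
        next
          case nz: False
          let ?\<gamma> = "\<alpha> + real j *\<^sub>R \<beta>"
          obtain d where \<gamma>: "?\<gamma> \<in> \<Phi>" and d: "(?ad ^^ j) Z = mat d ** X ?\<gamma>"
            using Suc nz by blast
          have S: "(?ad ^^ Suc j) Z = mat (d * t) ** lie_bracket (X \<beta>) (X ?\<gamma>)"
            by (simp add: d lie_bracket_mat mat_mult_mat)
          have eq: "\<beta> + ?\<gamma> = \<alpha> + real (Suc j) *\<^sub>R \<beta>"
            by (simp add: algebra_simps)
          \<comment> \<open>If the string reached 0, \<alpha> would be a negative multiple of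
            \<beta>, hence equal to - \<beta> because the root system is reduced.\<close>
          have "\<beta> + ?\<gamma> \<noteq> 0"
          proof
            assume "\<beta> + ?\<gamma> = 0"
            then have "\<alpha> = (- real (Suc j)) *\<^sub>R \<beta>"
              by (metis eq eq_neg_iff_add_eq_0 scaleR_minus_left)
            moreover from this have "- real (Suc j) = 1 \<or> - real (Suc j) = - 1"
              using scaled_root [OF assms(1)] Z(2) by metis
            ultimately show False
              using False by auto
          qed
          then show ?thesis
            using X_sum_bracket [OF assms(1) \<gamma>] X_commute [OF assms(1) \<gamma>]
            unfolding S eq [symmetric]
            by (cases "\<beta> + ?\<gamma> \<in> \<Phi>") (auto simp: mm.zero_right mat_mult_mat)
        qed
      qed
      have "inj (\<lambda>j :: nat. \<alpha> + real j *\<^sub>R \<beta>)"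
        using root_nz [OF assms(1)] by (intro injI) simp
      then have "\<not> range (\<lambda>j :: nat. \<alpha> + real j *\<^sub>R \<beta>) \<subseteq> \<Phi>"
        using finite_roots finite_subset range_inj_infinite by blast
      with string show ?thesis
        by blast
    qed
  next
    fix c h assume "Z = mat c ** H h" "h \<in> span \<Phi>"
    then show ?thesis
      using H by blast
  qed
qed

text \<open>On a generator, nilpotency lets \<open>mat_exp_ad\<close> express the conjugate as a
  finite sum of iterated brackets, which lie in \<open>gens\<close>. Keeping the root element on the
  right allows the three factors of \<open>w_elt\<close> to be chained.\<close>

lemma x_span_gens:
  assumes "\<beta> \<in> \<Phi>" "Z \<in> span gens"
  shows "\<exists>Z'\<in>span gens. x \<beta> t ** Z = Z' ** x \<beta> t"
  using assms(2)
proof (induction Z rule: span_induct_alt)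
  case base
  show ?case
    using span_zero mm.zero_left mm.zero_right by metis
next
  case (step c Z Y)
  let ?E = "mat t ** X \<beta>"
  obtain m where m: "(lie_bracket ?E ^^ m) Z = 0"
    using ad_nilpotent assms(1) step(1) by blast
  let ?Z = "\<Sum>j<m. (1 / fact j) *\<^sub>R (lie_bracket ?E ^^ j) Z"
  have "(lie_bracket ?E ^^ j) Z \<in> gens" for j
    by (induction j) (simp_all add: step(1) ad_gens assms(1))
  then have "?Z \<in> span gens"
    by (intro span_sum span_scale span_base)
  moreover have "x \<beta> t ** Z = ?Z ** x \<beta> t"
    using mat_exp_ad [OF m] by (simp add: root_elt_def)
  moreover obtain Y' where "Y' \<in> span gens" "x \<beta> t ** Y = Y' ** x \<beta> t"
    using step by blast
  ultimately show ?case
    by (intro bexI [of _ "c *\<^sub>R ?Z + Y'"])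
      (simp_all add: mm.add_left mm.add_right mm.scaleR_left mm.scaleR_right span_add span_scale)
qed

text \<open>These are the coordinates to which the linear independence \<open>indep\<close> applies.
  The matrices admitting them form a real subspace V, and V contains \<open>gens\<close>.\<close>

lemma span_gens_expansion:
  assumes "Z \<in> span gens"
  shows "\<exists>a b. Z = (\<Sum>\<alpha>\<in>\<Phi>. mat (a \<alpha>) ** X \<alpha>) + (\<Sum>\<delta>\<in>\<Delta>. mat (b \<delta>) ** H (coroot \<delta>))"
proof -
  define V where "V = {Z. \<exists>a b. Z = (\<Sum>\<alpha>\<in>\<Phi>. mat (a \<alpha>) ** X \<alpha>) + (\<Sum>\<delta>\<in>\<Delta>. mat (b \<delta>) ** H (coroot \<delta>))}"
  have VI: "(\<Sum>\<alpha>\<in>\<Phi>. mat (a \<alpha>) ** X \<alpha>) + (\<Sum>\<delta>\<in>\<Delta>. mat (b \<delta>) ** H (coroot \<delta>)) \<in> V" for a b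
    by (auto simp: V_def)
  have mat_add: "mat (a + b) ** A = mat a ** A + mat b ** A" for a b and A :: "'n cmat"
    by (simp add: vec_eq_iff distrib_right)
  have "subspace V"
  proof (rule subspaceI)
    show "0 \<in> V"
      using VI [of "\<lambda>_. 0" "\<lambda>_. 0"] by (simp add: mm.zero_left)
  next
    fix Y Z assume "Y \<in> V" "Z \<in> V"
    then obtain a b a' b' where
      "Y = (\<Sum>\<alpha>\<in>\<Phi>. mat (a \<alpha>) ** X \<alpha>) + (\<Sum>\<delta>\<in>\<Delta>. mat (b \<delta>) ** H (coroot \<delta>))"
      "Z = (\<Sum>\<alpha>\<in>\<Phi>. mat (a' \<alpha>) ** X \<alpha>) + (\<Sum>\<delta>\<in>\<Delta>. mat (b' \<delta>) ** H (coroot \<delta>))"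
      by (auto simp: V_def)
    then show "Y + Z \<in> V"
      using VI [of "\<lambda>\<alpha>. a \<alpha> + a' \<alpha>" "\<lambda>\<delta>. b \<delta> + b' \<delta>"] by (simp add: mat_add sum.distrib ac_simps)
  next
    fix r Z assume "Z \<in> V"
    then obtain a b where
      "Z = (\<Sum>\<alpha>\<in>\<Phi>. mat (a \<alpha>) ** X \<alpha>) + (\<Sum>\<delta>\<in>\<Delta>. mat (b \<delta>) ** H (coroot \<delta>))"
      by (auto simp: V_def)
    then show "r *\<^sub>R Z \<in> V"
      using VI [of "\<lambda>\<alpha>. of_real r * a \<alpha>" "\<lambda>\<delta>. of_real r * b \<delta>"]
      by (simp add: scaleR_sum_right scaleR_add_right mat_of_real_mult flip: mat_mult_mat)
  qed
  moreover have "gens \<subseteq> V"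
  proof
    fix Z assume "Z \<in> gens"
    then show "Z \<in> V"
      unfolding gens_def
    proof (elim UnE CollectE exE conjE)
      fix c \<alpha> assume "Z = mat c ** X \<alpha>" "\<alpha> \<in> \<Phi>"
      moreover have "mat (if \<beta> = \<alpha> then c else 0) ** X \<beta> = (if \<beta> = \<alpha> then mat c ** X \<alpha> else 0)" for \<beta>
        by (simp add: mm.zero_left)
      ultimately show "Z \<in> V"
        using VI [of "\<lambda>\<beta>. if \<beta> = \<alpha> then c else 0" "\<lambda>_. 0"] finite_roots by (simp add: mm.zero_left)
    next
      fix c h assume Z: "Z = mat c ** H h" "h \<in> span \<Phi>"
      \<comment> \<open>Simple roots span all roots; rescaling them to coroots then gives the
        coefficients of the Cartan part.\<close>
      have "span \<Phi> \<subseteq> span \<Delta>"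
        using root_in_span_simple by (intro span_minimal) auto
      then have "h \<in> span \<Delta>"
        using Z(2) by auto
      then obtain r where r: "h = (\<Sum>\<delta>\<in>\<Delta>. r \<delta> *\<^sub>R \<delta>)"
        using finite_simple_roots by (auto simp: span_finite)
      have "r \<delta> *\<^sub>R \<delta> = (r \<delta> * (\<delta> \<bullet> \<delta> / 2)) *\<^sub>R coroot \<delta>" for \<delta>
        by (metis scaleR_coroot scaleR_scaleR)
      then have "h = (\<Sum>\<delta>\<in>\<Delta>. (r \<delta> * (\<delta> \<bullet> \<delta> / 2)) *\<^sub>R coroot \<delta>)"
        by (simp add: r)
      then have "Z = (\<Sum>\<delta>\<in>\<Delta>. mat (c * of_real (r \<delta> * (\<delta> \<bullet> \<delta> / 2))) ** H (coroot \<delta>))"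
        by (simp only: Z linear_sum [OF linear_H] linear_cmul [OF linear_H] mm.sum_right mat_of_real_mult
            flip: mat_mult_mat)
      then show "Z \<in> V"
        using VI [of "\<lambda>_. 0" "\<lambda>\<delta>. c * of_real (r \<delta> * (\<delta> \<bullet> \<delta> / 2))"] by (simp add: mm.zero_left)
    qed
  qed
  ultimately have "span gens \<subseteq> V"
    by (intro span_minimal)
  with assms show ?thesis
    by (auto simp: V_def)
qed

text \<open>Expand Y and compare coefficients in the weight equations. Pairing \<gamma> with its own
  coroot gives 2, which kills the Cartan part. A nonzero coefficient at \<alpha> would make \<alpha>
  - \<gamma> orthogonal to all coroots, hence to \<alpha> and \<gamma>, hence to itself.\<close>

lemma weight_vector:
  assumes Y: "Y \<in> span gens" and "\<gamma> \<in> \<Phi>"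
    and wt: "\<And>\<delta>. \<delta> \<in> \<Phi> \<Longrightarrow> lie_bracket (H (coroot \<delta>)) Y = (\<gamma> \<bullet> coroot \<delta>) *\<^sub>R Y"
  shows "\<exists>a. Y = mat a ** X \<gamma>"
proof -
  obtain a b where ab: "Y = (\<Sum>\<alpha>\<in>\<Phi>. mat (a \<alpha>) ** X \<alpha>) + (\<Sum>\<delta>\<in>\<Delta>. mat (b \<delta>) ** H (coroot \<delta>))"
    using span_gens_expansion [OF Y] by blast
  have rel: "(\<forall>\<alpha>\<in>\<Phi>. of_real ((\<alpha> - \<gamma>) \<bullet> coroot \<delta>) * a \<alpha> = 0) \<and>
      (\<forall>\<epsilon>\<in>\<Delta>. of_real (- (\<gamma> \<bullet> coroot \<delta>)) * b \<epsilon> = 0)" if "\<delta> \<in> \<Phi>" for \<delta>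
  proof (rule indep)
    have "lie_bracket (H (coroot \<delta>)) Y = (\<Sum>\<alpha>\<in>\<Phi>. (\<alpha> \<bullet> coroot \<delta>) *\<^sub>R (mat (a \<alpha>) ** X \<alpha>))"
    proof -
      have "lie_bracket (H (coroot \<delta>)) Y
          = (\<Sum>\<alpha>\<in>\<Phi>. lie_bracket (H (coroot \<delta>)) (mat (a \<alpha>) ** X \<alpha>))
            + (\<Sum>\<epsilon>\<in>\<Delta>. lie_bracket (H (coroot \<delta>)) (mat (b \<epsilon>) ** H (coroot \<epsilon>)))"
        by (simp only: ab linear_add [OF linear_lie_bracket] linear_sum [OF linear_lie_bracket])
      moreover have "(\<Sum>\<epsilon>\<in>\<Delta>. lie_bracket (H (coroot \<delta>)) (mat (b \<epsilon>) ** H (coroot \<epsilon>))) = 0"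
        using that simple_roots_subset by (intro sum.neutral) (auto simp: lie_bracket_mat H_H mm.zero_right)
      moreover have "lie_bracket (H (coroot \<delta>)) (mat (a \<alpha>) ** X \<alpha>) = (\<alpha> \<bullet> coroot \<delta>) *\<^sub>R (mat (a \<alpha>) ** X \<alpha>)"
        if "\<alpha> \<in> \<Phi>" for \<alpha>
        using that \<open>\<delta> \<in> \<Phi>\<close> by (simp add: lie_bracket_mat H_X mat_of_real_mult mm.scaleR_right)
      ultimately show ?thesis
        by simp
    qed
    moreover have "(\<gamma> \<bullet> coroot \<delta>) *\<^sub>R Y
        = (\<Sum>\<alpha>\<in>\<Phi>. (\<gamma> \<bullet> coroot \<delta>) *\<^sub>R (mat (a \<alpha>) ** X \<alpha>))
          + (\<Sum>\<epsilon>\<in>\<Delta>. (\<gamma> \<bullet> coroot \<delta>) *\<^sub>R (mat (b \<epsilon>) ** H (coroot \<epsilon>)))"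
      by (simp add: ab scaleR_add_right scaleR_sum_right)
    ultimately have "(\<Sum>\<alpha>\<in>\<Phi>. (\<alpha> \<bullet> coroot \<delta>) *\<^sub>R (mat (a \<alpha>) ** X \<alpha>))
        - (\<Sum>\<alpha>\<in>\<Phi>. (\<gamma> \<bullet> coroot \<delta>) *\<^sub>R (mat (a \<alpha>) ** X \<alpha>))
        - (\<Sum>\<epsilon>\<in>\<Delta>. (\<gamma> \<bullet> coroot \<delta>) *\<^sub>R (mat (b \<epsilon>) ** H (coroot \<epsilon>))) = 0"
      using wt [OF that] by (simp add: algebra_simps)
    then show "(\<Sum>\<alpha>\<in>\<Phi>. mat (of_real ((\<alpha> - \<gamma>) \<bullet> coroot \<delta>) * a \<alpha>) ** X \<alpha>)
        + (\<Sum>\<epsilon>\<in>\<Delta>. mat (of_real (- (\<gamma> \<bullet> coroot \<delta>)) * b \<epsilon>) ** H (coroot \<epsilon>)) = 0"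
      by (simp only: mat_of_real_mult inner_diff_left scaleR_diff_left scaleR_minus_left
          sum_subtractf sum_negf flip: mat_mult_mat) simp
  qed
  have "b \<epsilon> = 0" if "\<epsilon> \<in> \<Delta>" for \<epsilon>
    using rel [OF \<open>\<gamma> \<in> \<Phi>\<close>] that inner_coroot_self [OF root_nz [OF \<open>\<gamma> \<in> \<Phi>\<close>]] by auto
  moreover have "a \<alpha> = 0" if "\<alpha> \<in> \<Phi>" "\<alpha> \<noteq> \<gamma>" for \<alpha>
  proof (rule ccontr)
    assume "a \<alpha> \<noteq> 0"
    then have orth: "(\<alpha> - \<gamma>) \<bullet> coroot \<delta> = 0" if "\<delta> \<in> \<Phi>" for \<delta>
      using rel [OF that] \<open>\<alpha> \<in> \<Phi>\<close> by auto
    have "(\<alpha> - \<gamma>) \<bullet> \<delta> = 0" if "\<delta> \<in> \<Phi>" for \<delta>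
      using orth [OF that] scaleR_coroot [of \<delta>] by (metis inner_scaleR_right mult_zero_right)
    then have "(\<alpha> - \<gamma>) \<bullet> (\<alpha> - \<gamma>) = 0"
      using that \<open>\<gamma> \<in> \<Phi>\<close> by (simp add: inner_diff_right [of "\<alpha> - \<gamma>"])
    with that show False
      by simp
  qed
  ultimately have "Y = (\<Sum>\<alpha>\<in>\<Phi>. if \<alpha> = \<gamma> then mat (a \<gamma>) ** X \<gamma> else 0)"
    unfolding ab by (auto simp: mm.zero_left intro!: sum.cong)
  then show ?thesis
    using finite_roots \<open>\<gamma> \<in> \<Phi>\<close> by auto
qed

text \<open>Conjugation by \<open>w_elt\<close> stays in the Lie algebra and acts on the Cartan part
  by the reflection, so the image of \<open>X \<alpha>\<close> has the reflected weight and
  \<open>weight_vector\<close> identifies it.\<close>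

lemma w_elt_X:
  assumes "\<beta> \<in> \<Phi>" "\<alpha> \<in> \<Phi>" "t \<noteq> 0"
  shows "\<exists>a. w_elt D \<beta> t ** X \<alpha> = mat a ** X (reflection \<beta> \<alpha>) ** w_elt D \<beta> t"
proof -
  let ?w = "w_elt D \<beta> t"
  have "X \<alpha> \<in> span gens"
    using X_in_gens [OF assms(2), of 1] by (simp add: span_base)
  then obtain Z1 where Z1: "Z1 \<in> span gens" "x \<beta> t ** X \<alpha> = Z1 ** x \<beta> t"
    using x_span_gens assms(1) by blast
  then obtain Z2 where Z2: "Z2 \<in> span gens" "x (- \<beta>) (- inverse t) ** Z1 = Z2 ** x (- \<beta>) (- inverse t)"
    using x_span_gens uminus_root assms(1) by blast
  then obtain Y where Y: "Y \<in> span gens" "x \<beta> t ** Z2 = Y ** x \<beta> t"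
    using x_span_gens assms(1) by blast
  have wY: "?w ** X \<alpha> = Y ** ?w"
    unfolding w_elt_def by (metis Z1(2) Z2(2) Y(2) matrix_mul_assoc)
  have "lie_bracket (H (coroot \<delta>)) Y = (reflection \<beta> \<alpha> \<bullet> coroot \<delta>) *\<^sub>R Y" if "\<delta> \<in> \<Phi>" for \<delta>
  proof -
    \<comment> \<open>Chosen so that conjugation by \<open>?w\<close> carries \<open>H h\<close> to
      \<open>H (coroot \<delta>)\<close>.\<close>
    define h where "h = reflection \<beta> (coroot \<delta>)"
    have h: "h \<in> span \<Phi>"
      by (simp add: h_def reflection_in_span coroot_in_span assms that)
    have wh: "?w ** H h = H (coroot \<delta>) ** ?w"
      using w_elt_H [OF assms(1) h assms(3)] reflection_reflection [OF root_nz [OF assms(1)]]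
      by (simp add: h_def)
    have "lie_bracket (H (coroot \<delta>)) Y ** ?w = ?w ** lie_bracket (H h) (X \<alpha>)"
      unfolding lie_bracket_def mm.diff_left mm.diff_right
      by (metis wh wY matrix_mul_assoc)
    also have "\<dots> = (\<alpha> \<bullet> h) *\<^sub>R Y ** ?w"
      by (simp add: H_X_span h assms mm.scaleR_right mm.scaleR_left wY)
    also have "\<alpha> \<bullet> h = reflection \<beta> \<alpha> \<bullet> coroot \<delta>"
      using inner_reflection [OF root_nz [OF assms(1)], of \<alpha> h]
        reflection_reflection [OF root_nz [OF assms(1)]] by (simp add: h_def)
    finally have "lie_bracket (H (coroot \<delta>)) Y ** ?w ** matrix_inv ?w
        = (reflection \<beta> \<alpha> \<bullet> coroot \<delta>) *\<^sub>R Y ** ?w ** matrix_inv ?w"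
      by simp
    then show ?thesis
      by (simp add: matrix_inv_right invertible_w_elt assms(1) flip: matrix_mul_assoc)
  qed
  then obtain a where "Y = mat a ** X (reflection \<beta> \<alpha>)"
    using weight_vector Y(1) reflection_root assms by blast
  with wY show ?thesis
    by auto
qed

section \<open>Group elements permuting the root lines\<close>

abbreviation W where "W \<equiv> carrier (weyl D)"
abbreviation N where "N \<equiv> carrier (Nrm D)"
abbreviation G where "G \<equiv> carrier (chev_group D)"

text \<open>The scalars at \<alpha> and - \<alpha> are required to be mutually inverse: this
  survives products and inverses, and it makes conjugation restrict to a \<open>twist\<close> on the
  rank one subgroups.\<close>

definition acts :: "'n cmat \<Rightarrow> ('e \<Rightarrow> 'e) \<Rightarrow> bool" where
  "acts g v \<longleftrightarrow> invertible g \<and> v ` \<Phi> \<subseteq> \<Phi> \<and>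
     (\<forall>\<alpha>\<in>\<Phi>. \<exists>a. a \<noteq> 0 \<and> g ** X \<alpha> = mat a ** X (v \<alpha>) ** g \<and>
        g ** X (- \<alpha>) = mat (inverse a) ** X (- v \<alpha>) ** g)"

lemma actsD:
  assumes "acts g v" "\<alpha> \<in> \<Phi>"
  shows "\<exists>a. a \<noteq> 0 \<and> g ** X \<alpha> = mat a ** X (v \<alpha>) ** g \<and>
    g ** X (- \<alpha>) = mat (inverse a) ** X (- v \<alpha>) ** g"
  using assms by (simp add: acts_def)

text \<open>With scalars a at \<alpha> and b at - \<alpha>, conjugating the bracket of the two root
  vectors gives a * b times \<open>H (coroot \<gamma>)\<close>, while \<open>w_elt_H\<close> gives
  \<open>H (coroot \<gamma>)\<close> itself. This is nonzero, so a * b = 1.\<close>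

lemma acts_w_elt:
  assumes "\<beta> \<in> \<Phi>" "t \<noteq> 0"
  shows "acts (w_elt D \<beta> t) (reflection \<beta>)"
proof -
  let ?w = "w_elt D \<beta> t"
  have inv: "invertible ?w"
    using assms(1) by (rule invertible_w_elt)
  have "\<exists>a. a \<noteq> 0 \<and> ?w ** X \<alpha> = mat a ** X (reflection \<beta> \<alpha>) ** ?w \<and>
        ?w ** X (- \<alpha>) = mat (inverse a) ** X (- reflection \<beta> \<alpha>) ** ?w" if "\<alpha> \<in> \<Phi>" for \<alpha>
  proof -
    define \<gamma> where "\<gamma> = reflection \<beta> \<alpha>"
    have "\<gamma> \<in> \<Phi>"
      by (simp add: \<gamma>_def reflection_root assms that)
    obtain a where a: "?w ** X \<alpha> = mat a ** X \<gamma> ** ?w"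
      using w_elt_X [OF assms(1) \<open>\<alpha> \<in> \<Phi>\<close> assms(2)] by (auto simp: \<gamma>_def)
    have "reflection \<beta> (- \<alpha>) = - \<gamma>"
      by (simp add: \<gamma>_def linear_neg linear_reflection)
    then obtain b where b: "?w ** X (- \<alpha>) = mat b ** X (- \<gamma>) ** ?w"
      using w_elt_X [OF assms(1) uminus_root [OF \<open>\<alpha> \<in> \<Phi>\<close>] assms(2)] by auto
    have "?w ** H (coroot \<alpha>) = H (coroot \<gamma>) ** ?w"
      using w_elt_H [OF assms(1) coroot_in_span [OF that] assms(2)]
      by (simp add: \<gamma>_def coroot_orthogonal orthogonal_reflection root_nz assms)
    moreover have "?w ** lie_bracket (X \<alpha>) (X (- \<alpha>))
        = lie_bracket (mat a ** X \<gamma>) (mat b ** X (- \<gamma>)) ** ?w"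
      unfolding lie_bracket_def mm.diff_left mm.diff_right by (metis a b matrix_mul_assoc)
    ultimately have "H (coroot \<gamma>) ** ?w = mat (a * b) ** H (coroot \<gamma>) ** ?w"
      by (simp add: X_neg that \<open>\<gamma> \<in> \<Phi>\<close> lie_bracket_mat mat_mult_mat mult.commute)
    then have "H (coroot \<gamma>) = mat (a * b) ** H (coroot \<gamma>)"
      by (metis inv matrix_inv_right matrix_mul_assoc matrix_mul_rid)
    then have "mat (a * b - 1) ** H (coroot \<gamma>) = 0"
      by (simp add: vec_eq_iff left_diff_distrib)
    then have "a * b = 1"
      using H_coroot_nz \<open>\<gamma> \<in> \<Phi>\<close> by (auto simp: mat_mult_eq_0_iff)
    then have "a \<noteq> 0" "b = inverse a"
      by (auto simp: inverse_unique)
    with a b show ?thesis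
      by (auto simp: \<gamma>_def)
  qed
  with inv assms show ?thesis
    by (auto simp: acts_def reflection_root)
qed

lemma acts_one: "acts (mat 1) id"
  by (auto simp: acts_def invertible_def intro!: exI [of _ 1] exI [of _ "mat 1"])

lemma acts_mult:
  assumes "acts g v" "acts g' v'"
  shows "acts (g ** g') (v \<circ> v')"
proof -
  have "\<exists>a. a \<noteq> 0 \<and> (g ** g') ** X \<alpha> = mat a ** X ((v \<circ> v') \<alpha>) ** (g ** g') \<and>
        (g ** g') ** X (- \<alpha>) = mat (inverse a) ** X (- (v \<circ> v') \<alpha>) ** (g ** g')" if "\<alpha> \<in> \<Phi>" for \<alpha>
  proof -
    obtain a where a: "a \<noteq> 0" "g' ** X \<alpha> = mat a ** X (v' \<alpha>) ** g'"
        "g' ** X (- \<alpha>) = mat (inverse a) ** X (- v' \<alpha>) ** g'"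
      using actsD [OF assms(2) \<open>\<alpha> \<in> \<Phi>\<close>] by (elim exE conjE) (rule that)
    have "v' \<alpha> \<in> \<Phi>"
      using assms(2) that by (auto simp: acts_def)
    then obtain b where b: "b \<noteq> 0" "g ** X (v' \<alpha>) = mat b ** X (v (v' \<alpha>)) ** g"
        "g ** X (- v' \<alpha>) = mat (inverse b) ** X (- v (v' \<alpha>)) ** g"
      using actsD [OF assms(1) \<open>v' \<alpha> \<in> \<Phi>\<close>] by (elim exE conjE) (rule that)
    have comp: "(g ** g') ** Y = mat (c * d) ** Z ** (g ** g')"
      if "g' ** Y = mat c ** Y' ** g'" "g ** Y' = mat d ** Z ** g" for Y Y' Z c d
    proof -
      have "(g ** g') ** Y = mat c ** (g ** Y') ** g'"
        by (metis mat_left_comm matrix_mul_assoc that(1))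
      then show ?thesis
        by (simp only: that(2) mat_mult_mat matrix_mul_assoc [symmetric])
    qed
    show ?thesis
      using comp [OF a(2) b(2)] comp [OF a(3) b(3)] a(1) b(1)
      by (intro exI [of _ "a * b"]) simp
  qed
  moreover have "(v \<circ> v') ` \<Phi> \<subseteq> \<Phi>" "invertible (g ** g')"
    using assms by (auto simp: acts_def invertible_mult image_subset_iff)
  ultimately show ?thesis
    by (simp add: acts_def)
qed

lemma acts_matrix_inv:
  assumes "acts g v" "v' ` \<Phi> \<subseteq> \<Phi>" "\<And>\<alpha>. \<alpha> \<in> \<Phi> \<Longrightarrow> v (v' \<alpha>) = \<alpha>"
  shows "acts (matrix_inv g) v'"
proof -
  have inv: "invertible g"
    using assms by (simp add: acts_def)
  have "\<exists>a. a \<noteq> 0 \<and> matrix_inv g ** X \<alpha> = mat a ** X (v' \<alpha>) ** matrix_inv g \<and>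
        matrix_inv g ** X (- \<alpha>) = mat (inverse a) ** X (- v' \<alpha>) ** matrix_inv g" if "\<alpha> \<in> \<Phi>" for \<alpha>
  proof -
    have "v' \<alpha> \<in> \<Phi>"
      using assms(2) that by auto
    then obtain a where a: "a \<noteq> 0" "g ** X (v' \<alpha>) = mat a ** X \<alpha> ** g"
        "g ** X (- v' \<alpha>) = mat (inverse a) ** X (- \<alpha>) ** g"
      using actsD [OF assms(1) \<open>v' \<alpha> \<in> \<Phi>\<close>] unfolding assms(3) [OF \<open>\<alpha> \<in> \<Phi>\<close>]
      by (elim exE conjE) (rule that)
    have move: "matrix_inv g ** Y = mat (inverse c) ** Z ** matrix_inv g"
      if "g ** Z = mat c ** Y ** g" "c \<noteq> 0" for Y Z c
    proof -
      have "mat (inverse c) ** Z ** matrix_inv g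
          = mat (inverse c) ** (matrix_inv g ** (g ** Z) ** matrix_inv g)"
        by (simp only: invertible_cancel(1) [OF inv] matrix_mul_assoc [symmetric])
      also have "\<dots> = mat (inverse c) ** (mat c ** (matrix_inv g ** Y))"
        by (simp only: that(1) matrix_mul_assoc [symmetric] matrix_inv_right [OF inv]
            mat_left_comm [of "matrix_inv g"] matrix_mul_rid)
      finally show ?thesis
        using that(2) by (simp add: mat_mult_mat)
    qed
    show ?thesis
      using move [OF a(2)] move [OF a(3)] a(1) by (intro exI [of _ "inverse a"]) simp
  qed
  with assms inv show ?thesis
    by (simp add: acts_def invertible_matrix_inv)
qed

section \<open>The groups \<open>G\<close>, \<open>K\<close> and \<open>\<N>\<close>\<close>

lemma subgroup_G: "subgroup G GL"
  unfolding chev_group_def by (simp, rule GL.generate_is_subgroup) (auto simp: invertible_x)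

lemma group_G: "group (chev_group D)"
  using GL.subgroup_imp_group [OF subgroup_G] by (simp add: chev_group_def)

lemma G_invertible: "g \<in> G \<Longrightarrow> invertible g"
  and G_mult: "g \<in> G \<Longrightarrow> h \<in> G \<Longrightarrow> g ** h \<in> G"
  using subgroup.subset [OF subgroup_G] subgroup.m_closed [OF subgroup_G] by auto

lemma G_inv: "g \<in> G \<Longrightarrow> matrix_inv g \<in> G"
  using subgroup.m_inv_closed [OF subgroup_G, of g] G_invertible by simp

lemma x_in_G: "\<alpha> \<in> \<Phi> \<Longrightarrow> x \<alpha> t \<in> G"
  by (auto simp: chev_group_def intro: generate.incl)

lemma w_elt_in_G: "\<alpha> \<in> \<Phi> \<Longrightarrow> w_elt D \<alpha> t \<in> G"
  by (simp add: w_elt_def G_mult x_in_G uminus_root)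

lemma h_elt_in_G: "\<alpha> \<in> \<Phi> \<Longrightarrow> h_elt D \<alpha> t \<in> G"
  by (simp add: h_elt_def G_mult G_inv w_elt_in_G)

lemma subgroup_torus: "subgroup (torus D) GL"
  unfolding torus_def by (rule GL.generate_is_subgroup) (auto simp: h_elt_in_G G_invertible)

lemma torus_subset_G: "torus D \<subseteq> G"
  unfolding torus_def by (rule GL.generate_subgroup_incl [OF _ subgroup_G]) (auto simp: h_elt_in_G)

text \<open>A generator \<open>h_elt D \<alpha> t\<close> is \<open>w_elt D \<alpha> t\<close> times
  the inverse of \<open>omega D \<alpha>\<close>; both factors act by the reflection of \<alpha>,
  whose square is the identity.\<close>

lemma torus_acts: "g \<in> torus D \<Longrightarrow> acts g id"
proof -
  have h: "acts (h_elt D \<alpha> t) id" if "\<alpha> \<in> \<Phi>" "t \<noteq> 0" for \<alpha> t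
  proof -
    have "acts (matrix_inv (omega D \<alpha>)) (reflection \<alpha>)"
      using that by (intro acts_matrix_inv [OF acts_w_elt [of \<alpha> 1]])
        (auto simp: reflection_root reflection_reflection root_nz)
    then have "acts (h_elt D \<alpha> t) (reflection \<alpha> \<circ> reflection \<alpha>)"
      unfolding h_elt_def using that by (intro acts_mult acts_w_elt)
    moreover have "reflection \<alpha> \<circ> reflection \<alpha> = id"
      using that by (auto simp: fun_eq_iff reflection_reflection root_nz)
    ultimately show ?thesis
      by simp
  qed
  assume "g \<in> torus D"
  then show ?thesis
    unfolding torus_def
  proof (induction rule: generate.induct)
    case one
    show ?case using acts_one by (simp add: id_def)
  next
    case (incl h)
    then show ?case using h by (auto simp: id_def)
  next
    case (inv k)
    then have "acts k id"
      using h by auto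
    moreover from this have "invertible k"
      by (simp add: acts_def)
    ultimately show ?case
      using acts_matrix_inv [of k id id] by (simp add: id_def)
  next
    case (eng h1 h2)
    then show ?case
      using acts_mult [of h1 id h2 id] by (simp add: id_def comp_def)
  qed
qed

section \<open>Fixed points of \<sigma> and the compact torus\<close>

lemma sigma_mult: "g \<in> G \<Longrightarrow> h \<in> G \<Longrightarrow> sigma D (g ** h) = sigma D g ** sigma D h"
  and sigma_x: "\<alpha> \<in> \<Phi> \<Longrightarrow> sigma D (x \<alpha> t) = x (- \<alpha>) (- cnj t)"
  using chevalley by (auto simp: compact_chevalley_def iso_def hom_def chev_group_def)

lemma sigma_1: "sigma D (mat 1) = mat 1"
proof -
  have "sigma D \<in> hom (chev_group D) (chev_group D)"
    using chevalley by (auto simp: compact_chevalley_def iso_def)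
  then have "sigma D \<one>\<^bsub>chev_group D\<^esub> = \<one>\<^bsub>chev_group D\<^esub>"
    using group_G hom_one by blast
  then show ?thesis
    by (simp add: chev_group_def)
qed

lemma sigma_fixed_inv:
  assumes "g \<in> G" "sigma D g = g"
  shows "sigma D (matrix_inv g) = matrix_inv g"
proof -
  have "g ** sigma D (matrix_inv g) = mat 1"
    using sigma_mult [of g "matrix_inv g"] assms
    by (simp add: G_inv sigma_1 matrix_inv_right G_invertible)
  then show ?thesis
    by (metis G_invertible assms(1) invertible_cancel(1) matrix_mul_rid)
qed

lemma subgroup_fixed: "subgroup {g \<in> G. sigma D g = g} GL"
proof (rule GL.subgroupI)
  show "{g \<in> G. sigma D g = g} \<noteq> {}"
    using sigma_1 subgroup.one_closed [OF subgroup_G] by auto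
qed (auto simp: G_invertible G_inv G_mult sigma_fixed_inv sigma_mult)

lemma K_eq: "K = torus D \<inter> {g \<in> G. sigma D g = g}"
  using torus_subset_G by (auto simp: compact_torus_def)

lemma subgroup_K: "subgroup K GL"
  unfolding K_eq by (intro GL.subgroups_Inter_pair subgroup_torus subgroup_fixed)

lemma K_invertible: "k \<in> K \<Longrightarrow> invertible k"
  and K_mult: "k \<in> K \<Longrightarrow> l \<in> K \<Longrightarrow> k ** l \<in> K"
  and K_one: "mat 1 \<in> K"
  using subgroup.subset [OF subgroup_K] subgroup.m_closed [OF subgroup_K]
    subgroup.one_closed [OF subgroup_K] by auto

lemma K_inv: "k \<in> K \<Longrightarrow> matrix_inv k \<in> K"
  using subgroup.m_inv_closed [OF subgroup_K, of k] K_invertible by simp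

lemma omega_sl2hom:
  "\<alpha> \<in> \<Phi> \<Longrightarrow> omega D \<alpha> = sl2hom D \<alpha> (upper_unitri 1 ** lower_unitri (- 1) ** upper_unitri 1)"
  by (simp add: w_elt_def sl2hom_mult det_mul det_unitri sl2hom_upper sl2hom_lower)

text \<open>\<sigma> exchanges the root elements of \<alpha> and - \<alpha> with a sign, turning one
  expression for omega from \<open>unitri_braid\<close> into the other.\<close>

lemma sigma_omega:
  assumes "\<alpha> \<in> \<Phi>"
  shows "sigma D (omega D \<alpha>) = omega D \<alpha>"
proof -
  have "sigma D (omega D \<alpha>) = x (- \<alpha>) (- 1) ** x \<alpha> 1 ** x (- \<alpha>) (- 1)"
    using assms by (simp add: w_elt_def sigma_mult x_in_G uminus_root G_mult sigma_x)
  also have "\<dots> = omega D \<alpha>"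
    unfolding omega_sl2hom [OF assms] unitri_braid
    using assms by (simp add: sl2hom_mult det_mul det_unitri sl2hom_upper sl2hom_lower)
  finally show ?thesis .
qed

section \<open>The group \<N> and the Weyl group\<close>

lemma subgroup_N: "subgroup N GL"
  unfolding Nrm_def
  by (simp, rule GL.generate_is_subgroup) (auto simp: invertible_w_elt K_invertible)

lemma group_N: "group (Nrm D)"
  using GL.subgroup_imp_group [OF subgroup_N] by (simp add: Nrm_def)

lemma N_simps [simp]: "g \<otimes>\<^bsub>Nrm D\<^esub> h = g ** h" "\<one>\<^bsub>Nrm D\<^esub> = mat 1"
  by (simp_all add: Nrm_def)

lemma N_fixed: "g \<in> N \<Longrightarrow> g \<in> G" "g \<in> N \<Longrightarrow> sigma D g = g"
proof -
  have "N \<subseteq> {g \<in> G. sigma D g = g}"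
    unfolding Nrm_def
    by (simp, rule GL.generate_subgroup_incl [OF _ subgroup_fixed])
      (auto simp: K_eq w_elt_in_G sigma_omega)
  then show "g \<in> N \<Longrightarrow> g \<in> G" "g \<in> N \<Longrightarrow> sigma D g = g"
    by auto
qed

lemma N_invertible: "g \<in> N \<Longrightarrow> invertible g"
  by (simp add: G_invertible N_fixed)

lemma inv_N: "g \<in> N \<Longrightarrow> inv\<^bsub>Nrm D\<^esub> g = matrix_inv g"
  using GL.m_inv_consistent [OF subgroup_N, of g] by (simp add: Nrm_def N_invertible)

lemma K_subset_N: "K \<subseteq> N"
  by (auto simp: Nrm_def intro: generate.incl)

lemma subgroup_K_N: "subgroup K (Nrm D)"
  using GL.subgroup_incl [OF subgroup_K subgroup_N K_subset_N] by (simp add: Nrm_def)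

lemma group_W: "group (weyl D)"
  and W_bij: "v \<in> W \<Longrightarrow> bij v"
proof -
  have sub: "subgroup (generate (BijGroup UNIV) (reflection ` \<Phi>)) (BijGroup UNIV)"
    by (rule group.generate_is_subgroup [OF group_BijGroup])
      (auto simp: BijGroup_UNIV_simps orthogonal_transformation_bij orthogonal_reflection root_nz)
  show "group (weyl D)"
    unfolding weyl_group_def by (rule group.subgroup_imp_group [OF group_BijGroup sub])
  show "v \<in> W \<Longrightarrow> bij v"
    using subgroup.subset [OF sub] by (auto simp: weyl_group_def BijGroup_UNIV_simps)
qed

sublocale W: group "weyl D" by (rule group_W)

text \<open>
  Normality of \<open>K\<close> is forced by the existence of \<open>\<iota>\<close>: as \<open>\<iota>\<close> is onto the set of right cosets,
  \<open>K g K\<close> is a product of cosets in its image and hence a single coset \<open>K g\<close>.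
\<close>
lemma normal_K: "K \<lhd> Nrm D"
proof -
  interpret N: group "Nrm D" by (rule group_N)
  have hom: "\<iota> (u \<otimes>\<^bsub>weyl D\<^esub> v) = \<iota> u <#>\<^bsub>Nrm D\<^esub> \<iota> v" "\<iota> (u \<otimes>\<^bsub>weyl D\<^esub> v) \<in> rcosets\<^bsub>Nrm D\<^esub> K"
    if "u \<in> W" "v \<in> W" for u v
  proof -
    show eq: "\<iota> (u \<otimes>\<^bsub>weyl D\<^esub> v) = \<iota> u <#>\<^bsub>Nrm D\<^esub> \<iota> v"
      using iota_iso that by (auto simp: iso_def hom_def FactGroup_def)
    have "u \<otimes>\<^bsub>weyl D\<^esub> v \<in> W"
      using that by (rule W.m_closed)
    then show "\<iota> (u \<otimes>\<^bsub>weyl D\<^esub> v) \<in> rcosets\<^bsub>Nrm D\<^esub> K"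
      using iota_iso by (auto simp: iso_def hom_def FactGroup_def)
  qed
  have surj: "\<exists>v\<in>W. \<iota> v = K #>\<^bsub>Nrm D\<^esub> g" if "g \<in> N" for g
  proof -
    have "K #>\<^bsub>Nrm D\<^esub> g \<in> carrier (Nrm D Mod K)"
      using that by (auto simp: FactGroup_def RCOSETS_def)
    moreover have "\<iota> ` W = carrier (Nrm D Mod K)"
      using iota_iso by (simp add: iso_def bij_betw_def)
    ultimately show ?thesis
      by (metis imageE)
  qed
  have "g ** k ** matrix_inv g \<in> K" if g: "g \<in> N" and k: "k \<in> K" for g k
  proof -
    have k1: "mat 1 \<in> N"
      using K_one K_subset_N by auto
    obtain u where u: "u \<in> W" "\<iota> u = K #>\<^bsub>Nrm D\<^esub> g"
      using surj [OF g] by (elim bexE) (rule that)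
    obtain v where v: "v \<in> W" "\<iota> v = K #>\<^bsub>Nrm D\<^esub> mat 1"
      using surj [OF k1] by (elim bexE) (rule that)
    obtain c where c: "c \<in> N" "\<iota> u <#>\<^bsub>Nrm D\<^esub> \<iota> v = K #>\<^bsub>Nrm D\<^esub> c"
      using hom [OF u(1) v(1)] by (auto simp: RCOSETS_def)
    have prod: "l ** g ** (m ** mat 1) \<in> K #>\<^bsub>Nrm D\<^esub> c" if "l \<in> K" "m \<in> K" for l m
    proof -
      have "l ** g \<in> \<iota> u" "m ** mat 1 \<in> \<iota> v"
        unfolding u v r_coset_def using that by auto
      then show ?thesis
        unfolding c(2) [symmetric] by (auto simp: set_mult_def)
    qed
    \<comment> \<open>Both g and g k lie in the coset K c; eliminating c exhibits the conjugate of k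
      as a quotient of two elements of K.\<close>
    obtain k1 where k1: "k1 \<in> K" "g = k1 ** c"
      using prod [OF K_one K_one] by (auto simp: r_coset_def)
    obtain k2 where k2: "k2 \<in> K" "g ** k = k2 ** c"
      using prod [OF K_one k] by (auto simp: r_coset_def)
    have "c = matrix_inv k1 ** g"
      using k1 K_invertible by simp
    then have "g ** k ** matrix_inv g = k2 ** matrix_inv k1"
      using N_invertible [OF g] by (simp add: k2 matrix_inv_right flip: matrix_mul_assoc)
    then show ?thesis
      using k1 k2 by (simp add: K_mult K_inv)
  qed
  then show ?thesis
    unfolding N.normal_inv_iff using subgroup_K_N by (simp add: inv_N)
qed

lemma W_mult [simp]: "u \<in> W \<Longrightarrow> v \<in> W \<Longrightarrow> u \<otimes>\<^bsub>weyl D\<^esub> v = u \<circ> v"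
  using W_bij [of u] W_bij [of v] by (simp add: weyl_group_def BijGroup_UNIV_simps)

lemma W_one [simp]: "\<one>\<^bsub>weyl D\<^esub> = id"
  by (simp add: weyl_group_def BijGroup_UNIV_simps)

lemma reflection_in_W: "\<alpha> \<in> \<Phi> \<Longrightarrow> reflection \<alpha> \<in> W"
  by (auto simp: weyl_group_def intro: generate.incl)

text \<open>Reflections are involutions, so inverses of generators are generators again and give no
  separate case.\<close>

lemma W_induct [consumes 1, case_names one reflection mult]:
  assumes "v \<in> W" "P id" "\<And>\<alpha>. \<alpha> \<in> \<Phi> \<Longrightarrow> P (reflection \<alpha>)"
    "\<And>u v. u \<in> W \<Longrightarrow> v \<in> W \<Longrightarrow> P u \<Longrightarrow> P v \<Longrightarrow> P (u \<circ> v)"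
  shows "P v"
proof -
  have "v \<in> generate (BijGroup UNIV) (reflection ` \<Phi>)"
    using assms(1) by (simp add: weyl_group_def)
  then show ?thesis
  proof (induction rule: generate.induct)
    case one
    then show ?case using assms(2) by (simp add: BijGroup_UNIV_simps id_def)
  next
    case (incl h)
    then show ?case using assms(3) by auto
  next
    case (inv h)
    then obtain \<alpha> where \<alpha>: "\<alpha> \<in> \<Phi>" "h = reflection \<alpha>"
      by auto
    have "bij h"
      by (simp add: \<alpha> orthogonal_transformation_bij orthogonal_reflection root_nz)
    moreover have "h \<circ> h = id"
      using \<alpha> by (auto simp: reflection_reflection root_nz)
    ultimately have "inv\<^bsub>BijGroup UNIV\<^esub> h = h"
      by (intro group.inv_equality [OF group_BijGroup]) (simp_all add: BijGroup_UNIV_simps)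
    then show ?case using assms(3) \<alpha> by simp
  next
    case (eng h1 h2)
    then have "h1 \<in> W" "h2 \<in> W"
      by (simp_all add: weyl_group_def)
    moreover from this have "h1 \<otimes>\<^bsub>BijGroup UNIV\<^esub> h2 = h1 \<circ> h2"
      using W_bij by (simp add: BijGroup_UNIV_simps)
    ultimately show ?case
      using assms(4) eng by (simp add: comp_def)
  qed
qed

lemma W_orthogonal: "v \<in> W \<Longrightarrow> orthogonal_transformation v"
  by (induction rule: W_induct)
    (simp_all add: orthogonal_transformation_id orthogonal_reflection root_nz
      orthogonal_transformation_compose [unfolded comp_def] id_def comp_def)

subsection \<open>Representatives of Weyl group elements\<close>

text \<open>The relation that g represents v in \<N>/K. It allows arbitrary representatives to be
  handled, with no reference to the chosen \<open>rep\<close>.\<close>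

definition lies :: "'n cmat \<Rightarrow> ('e \<Rightarrow> 'e) \<Rightarrow> bool" where
  "lies g v \<longleftrightarrow> v \<in> W \<and> g \<in> \<iota> v"

lemma lies_W: "lies g v \<Longrightarrow> v \<in> W"
  by (simp add: lies_def)

sublocale fact: group "Nrm D Mod K"
  by (rule normal.factorgroup_is_group [OF normal_K])

lemma iota_hom: "\<iota> \<in> hom (weyl D) (Nrm D Mod K)"
  using iota_iso by (simp add: iso_def)

lemma iota_rcoset: "v \<in> W \<Longrightarrow> \<iota> v \<in> rcosets\<^bsub>Nrm D\<^esub> K"
  using hom_in_carrier [OF iota_hom] by (simp add: FactGroup_def)

lemma lies_N: "lies g v \<Longrightarrow> g \<in> N"
  using iota_rcoset [of v] subgroup.rcosets_carrier [OF subgroup_K_N group_N] by (auto simp: lies_def)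

lemma lies_invertible: "lies g v \<Longrightarrow> invertible g"
  using lies_N N_invertible by blast

lemma lies_rep: "v \<in> W \<Longrightarrow> lies (rep D v) v"
  by (simp add: lies_def rep_in_iota)

lemma lies_mult: "lies g u \<Longrightarrow> lies h v \<Longrightarrow> lies (g ** h) (u \<circ> v)"
  using hom_mult [OF iota_hom, of u v] W.m_closed [of u v]
  by (auto simp: lies_def FactGroup_def set_mult_def)

lemma lies_id_iff: "lies k id \<longleftrightarrow> k \<in> K"
  using hom_one [OF iota_hom group_W fact.is_group] W.one_closed
  by (simp add: lies_def FactGroup_def)

lemma lies_matrix_inv: "lies g v \<Longrightarrow> lies (matrix_inv g) (inv\<^bsub>weyl D\<^esub> v)"
proof -
  assume g: "lies g v"
  interpret h: group_hom "weyl D" "Nrm D Mod K" \<iota>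
    by (simp add: group_hom_def group_hom_axioms_def group_W fact.is_group iota_hom)
  have "\<iota> (inv\<^bsub>weyl D\<^esub> v) = set_inv\<^bsub>Nrm D\<^esub> (\<iota> v)"
    using normal.inv_FactGroup [OF normal_K, of "\<iota> v"] lies_W [OF g] by simp
  then show ?thesis
    using g inv_N [OF lies_N [OF g]] by (auto simp: lies_def SET_INV_def intro!: bexI [of _ g])
qed

lemma lies_unique: "lies g v \<Longrightarrow> lies h v \<Longrightarrow> matrix_inv g ** h \<in> K"
  using lies_mult [OF lies_matrix_inv, of g v h v] W.l_inv [of v] W.inv_closed [of v]
  by (simp add: lies_W flip: lies_id_iff)

lemma lies_omega: "\<alpha> \<in> \<Phi> \<Longrightarrow> lies (omega D \<alpha>) (reflection \<alpha>)"
  using K_one by (auto simp: lies_def reflection_in_W iota_reflection l_coset_def intro!: bexI [of _ "mat 1"])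

lemma conj_K: "lies g v \<Longrightarrow> k \<in> K \<Longrightarrow> g ** k ** matrix_inv g \<in> K"
  and conj_K': "lies g v \<Longrightarrow> k \<in> K \<Longrightarrow> matrix_inv g ** k ** g \<in> K"
  using normal.inv_op_closed1 [OF normal_K, of g k] normal.inv_op_closed2 [OF normal_K, of g k]
  by (simp_all add: lies_N inv_N)

text \<open>Induction over W produces some representative h with this property; g differs from h by
  an element of K, which lies in the torus and acts over the identity.\<close>

lemma lies_acts: "lies g v \<Longrightarrow> acts g v"
proof -
  assume g: "lies g v"
  from lies_W [OF this] have "\<exists>h. lies h v \<and> acts h v"
  proof (induction rule: W_induct)
    case one
    then show ?case using acts_one K_one lies_id_iff by blast
  next
    case (reflection \<alpha>)
    then show ?case using lies_omega acts_w_elt [of \<alpha> 1] by auto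
  next
    case (mult u v)
    then show ?case using lies_mult acts_mult by blast
  qed
  then obtain h where h: "lies h v" "acts h v"
    by blast
  have "matrix_inv h ** g \<in> torus D"
    using lies_unique [OF h(1) g] by (simp add: K_eq)
  from acts_mult [OF h(2) torus_acts [OF this]] show ?thesis
    by (simp add: lies_invertible [OF h(1)])
qed

text \<open>If the root element is 1, \<open>x_H\<close> for the coroot of \<beta> forces 2 u times
  \<open>X \<beta>\<close> to vanish.\<close>

lemma x_eq_1_iff: "\<beta> \<in> \<Phi> \<Longrightarrow> x \<beta> u = mat 1 \<longleftrightarrow> u = 0"
  using x_H [OF _ coroot_in_span, of \<beta> \<beta> u] X_nz [of \<beta>] inner_coroot_self [OF root_nz, of \<beta>]
  by (auto simp: x_0 mat_mult_eq_0_iff)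

text \<open>Exponentiating the relations of \<open>acts\<close> gives both families. As \<sigma>
  fixes g, applying it to the relation for \<alpha> at t = 1 and comparing with the one for -
  \<alpha> at t = - 1 gives cnj a = inverse a by injectivity of t \<mapsto>
  \<open>x (- v \<alpha>) t\<close>.\<close>

lemma lies_unit:
  assumes "lies g v" "\<alpha> \<in> \<Phi>"
  shows "\<exists>a. cmod a = 1 \<and> (\<forall>t. g ** x \<alpha> t = x (v \<alpha>) (a * t) ** g \<and>
           g ** x (- \<alpha>) t = x (- v \<alpha>) (inverse a * t) ** g)"
proof -
  have v: "v \<alpha> \<in> \<Phi>"
    using lies_acts [OF assms(1)] assms(2) by (auto simp: acts_def)
  obtain a where a: "a \<noteq> 0" "g ** X \<alpha> = mat a ** X (v \<alpha>) ** g"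
      "g ** X (- \<alpha>) = mat (inverse a) ** X (- v \<alpha>) ** g"
    using actsD [OF lies_acts [OF assms(1)] assms(2)] by (elim exE conjE) (rule that)
  have exp: "g ** mat_exp (mat t ** Y) = mat_exp (mat (c * t) ** Z) ** g"
    if "g ** Y = mat c ** Z ** g" for Y Z c t
  proof (rule mat_exp_intertwine)
    have "g ** (mat t ** Y) = mat t ** (mat c ** (Z ** g))"
      by (simp only: mat_left_comm [of g] that) (simp only: matrix_mul_assoc)
    also have "\<dots> = mat (t * c) ** (Z ** g)"
      by (rule mat_mult_mat)
    finally show "g ** (mat t ** Y) = mat (c * t) ** Z ** g"
      by (simp add: matrix_mul_assoc mult.commute)
  qed
  have x: "g ** x \<alpha> t = x (v \<alpha>) (a * t) ** g" "g ** x (- \<alpha>) t = x (- v \<alpha>) (inverse a * t) ** g" for t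
    unfolding root_elt_def using exp [OF a(2)] exp [OF a(3)] by blast+
  have g: "g \<in> G" "sigma D g = g" "invertible g"
    using N_fixed lies_N [OF assms(1)] lies_invertible [OF assms(1)] by auto
  have "sigma D (g ** x \<alpha> 1) = g ** x (- \<alpha>) (- 1)"
    using g assms(2) by (simp add: sigma_mult x_in_G sigma_x)
  moreover have "sigma D (x (v \<alpha>) a ** g) = x (- v \<alpha>) (- cnj a) ** g"
    using g v by (simp add: sigma_mult x_in_G sigma_x)
  ultimately have "x (- v \<alpha>) (- cnj a) ** g = x (- v \<alpha>) (- inverse a) ** g"
    using x(1) [of 1] x(2) [of "- 1"] by simp
  then have "x (- v \<alpha>) (- cnj a) = x (- v \<alpha>) (- inverse a)"
    by (metis g(3) matrix_inv_right matrix_mul_assoc matrix_mul_rid)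
  then have "x (- v \<alpha>) (- cnj a) ** x (- v \<alpha>) (inverse a) = mat 1"
    using x_uminus(1) [OF uminus_root [OF v], of "- inverse a"] by simp
  then have "x (- v \<alpha>) (- cnj a + inverse a) = mat 1"
    by (simp only: x_add [OF uminus_root [OF v]])
  then have "cnj a = inverse a"
    using x_eq_1_iff uminus_root [OF v] by simp
  then have "a * cnj a = 1"
    using a(1) by simp
  then have "complex_of_real ((cmod a)\<^sup>2) = 1"
    by (simp only: complex_norm_square)
  then have "(cmod a)\<^sup>2 = 1"
    by (simp only: of_real_eq_1_iff)
  then have "cmod a = 1"
    using norm_ge_zero [of a] by (auto simp: power2_eq_1_iff)
  with x show ?thesis
    by blast
qed

text \<open>For unitriangular matrices this is \<open>lies_unit\<close>; \<open>twist\<close> and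
  \<open>sl2hom\<close> are multiplicative, so \<open>sl2_induct\<close> gives all of SL2.\<close>

lemma lies_sl2hom:
  assumes "lies g v" "\<alpha> \<in> \<Phi>"
  shows "\<exists>a. cmod a = 1 \<and> (\<forall>A. det A = 1 \<longrightarrow>
           g ** sl2hom D \<alpha> A = sl2hom D (v \<alpha>) (twist a A) ** g)"
proof -
  obtain a where a: "cmod a = 1" "\<And>t. g ** x \<alpha> t = x (v \<alpha>) (a * t) ** g"
      "\<And>t. g ** x (- \<alpha>) t = x (- v \<alpha>) (inverse a * t) ** g"
    using lies_unit [OF assms] by blast
  have "a \<noteq> 0"
    using a(1) by auto
  have v: "v \<alpha> \<in> \<Phi>"
    using lies_acts [OF assms(1)] assms(2) by (auto simp: acts_def)
  have "g ** sl2hom D \<alpha> A = sl2hom D (v \<alpha>) (twist a A) ** g" if "det A = 1" for A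
    using that
  proof (induction A rule: sl2_induct)
    case (upper t)
    then show ?case by (simp add: sl2hom_upper assms(2) v twist_upper a(2))
  next
    case (lower t)
    then show ?case by (simp add: sl2hom_lower assms(2) v twist_lower a(3))
  next
    case (mult A B)
    then show ?case
      using \<open>a \<noteq> 0\<close> by (simp add: sl2hom_mult assms(2) v twist_mult det_twist)
        (metis matrix_mul_assoc)
  qed
  with a(1) show ?thesis
    by blast
qed

section \<open>The sets \<open>C\<^sub>s\<close>\<close>

lemma C_refl_mult_K: "c \<in> C_refl D s \<Longrightarrow> k \<in> K \<Longrightarrow> c ** k \<in> C_refl D s"
  unfolding C_refl_def using K_mult by (fastforce simp flip: matrix_mul_assoc)

text \<open>The hypothesis \<open>eq\<close> is s' = v s v^-1 written without an inverse. The SU2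
  factor is twisted by a unit scalar, hence stays in SU2 and moves to the root v \<alpha>; the K
  factor stays in K by normality.\<close>

lemma C_refl_conj:
  assumes "lies g v" "c \<in> C_refl D s" and eq: "\<And>y. s' (v y) = v (s y)"
  shows "g ** c ** matrix_inv g \<in> C_refl D s'"
proof -
  obtain \<alpha> A k where c: "c = sl2hom D \<alpha> A ** k" "\<alpha> \<in> \<Phi>" "reflection \<alpha> = s" "A \<in> SU2" "k \<in> K"
    using assms(2) by (auto simp: C_refl_def)
  have orth: "orthogonal_transformation v"
    by (rule W_orthogonal [OF lies_W [OF assms(1)]])
  have "v \<alpha> \<in> \<Phi>"
    using lies_acts [OF assms(1)] c(2) by (auto simp: acts_def)
  moreover have "reflection (v \<alpha>) = s'"
  proof
    fix z
    obtain y where "z = v y"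
      using orth orthogonal_transformation_surj by (metis surjD)
    then show "reflection (v \<alpha>) z = s' z"
      by (simp add: reflection_orthogonal orth eq c(3))
  qed
  moreover obtain a where a: "cmod a = 1" "g ** sl2hom D \<alpha> A = sl2hom D (v \<alpha>) (twist a A) ** g"
    using lies_sl2hom [OF assms(1) c(2)] c(4) by (auto simp: SU2_def)
  have "g ** c ** matrix_inv g = sl2hom D (v \<alpha>) (twist a A) ** (g ** k ** matrix_inv g)"
    unfolding c(1) using a(2) by (metis matrix_mul_assoc)
  ultimately show ?thesis
    unfolding C_refl_def using twist_SU2 [OF a(1) c(4)] conj_K [OF assms(1) c(5)] by blast
qed

text \<open>Write k c as (k c k^-1) k and conjugate by k, which lies over the identity.\<close>

lemma K_mult_C_refl:
  assumes "k \<in> K" "c \<in> C_refl D s"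
  shows "k ** c \<in> C_refl D s"
proof -
  have "k ** c ** matrix_inv k ** k \<in> C_refl D s"
    using assms by (intro C_refl_mult_K C_refl_conj [of k id]) (simp_all add: lies_id_iff)
  then show ?thesis
    using K_invertible [OF assms(1)] by (simp add: matrix_inv_left flip: matrix_mul_assoc)
qed

text \<open>\<open>rep D u\<close> is in K for u = id. Otherwise it is
  \<open>omega D \<alpha>\<close> times some l in K; omega is the image of an element of SU2, and it
  can be moved to the left past k because it normalizes K.\<close>

lemma C_refl_mult_rep:
  assumes "c \<in> C_refl D s" "u = id \<or> u = s"
  shows "c ** rep D u \<in> C_refl D s"
proof -
  obtain \<alpha> A k where c: "c = sl2hom D \<alpha> A ** k" "\<alpha> \<in> \<Phi>" "reflection \<alpha> = s" "A \<in> SU2" "k \<in> K"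
    using assms(1) by (auto simp: C_refl_def)
  show ?thesis
  proof (cases "u = id")
    case True
    then have "rep D u \<in> K"
      using lies_rep W.one_closed by (metis W_one lies_id_iff)
    then show ?thesis
      by (rule C_refl_mult_K [OF assms(1)])
  next
    case False
    then have u: "u = reflection \<alpha>"
      using assms(2) c(3) by simp
    let ?\<omega> = "omega D \<alpha>"
    let ?B = "upper_unitri 1 ** lower_unitri (- 1) ** upper_unitri 1"
    have \<omega>: "lies ?\<omega> u" "invertible ?\<omega>"
      using lies_omega c(2) u invertible_w_elt by auto
    define l where "l = matrix_inv ?\<omega> ** rep D u"
    have l: "l \<in> K"
      unfolding l_def using lies_unique [OF \<omega>(1) lies_rep] lies_W \<omega>(1) by blast
    have "c ** rep D u = sl2hom D \<alpha> A ** ?\<omega> ** ((matrix_inv ?\<omega> ** k ** ?\<omega>) ** l)"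
      using \<omega>(2) by (simp add: c(1) l_def flip: matrix_mul_assoc)
    also have "sl2hom D \<alpha> A ** ?\<omega> = sl2hom D \<alpha> (A ** ?B)"
      using c(2,4) by (simp add: omega_sl2hom sl2hom_mult SU2_def det_mul det_unitri)
    finally show ?thesis
      unfolding C_refl_def
      using c(2,3) SU2_mult [OF c(4) unitri_braid_SU2] K_mult [OF conj_K' [OF \<omega>(1) c(5)] l]
      by blast
  qed
qed

lemma one_in_C_refl: "\<alpha> \<in> \<Phi> \<Longrightarrow> mat 1 \<in> C_refl D (reflection \<alpha>)"
proof -
  assume "\<alpha> \<in> \<Phi>"
  then have "sl2hom D \<alpha> (mat 1) ** mat 1 = mat 1"
    using sl2hom_upper [of \<alpha> 0] by (simp add: unitri_0 x_0)
  moreover have "mat 1 \<in> SU2"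
    by (simp add: SU2_def vec_eq_iff forall_2 matrix_matrix_mult_def sum_2 transpose_def
        map_matrix_def mat_def det_2)
  ultimately show ?thesis
    unfolding C_refl_def using \<open>\<alpha> \<in> \<Phi>\<close> K_one by (smt (verit) mem_Collect_eq)
qed

section \<open>Classes in Bott--Samelson spaces\<close>

text \<open>Unlike in \<^const>\<open>right_act\<close>, the value of \<open>k\<close> at \<open>0\<close> need not be \<open>1\<close>.\<close>
definition act :: "nat \<Rightarrow> (nat \<Rightarrow> 'n cmat) \<Rightarrow> (nat \<Rightarrow> 'n cmat) \<Rightarrow> nat \<Rightarrow> 'n cmat" where
  "act n c k = (\<lambda>i\<in>{1..n}. matrix_inv (k (i - 1)) ** c i ** k i)"

lemma right_act_eq_act: "right_act n c k = act n c (k(0 := mat 1))"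
  by (rule ext) (auto simp: right_act_def act_def)

text \<open>Only the entry at 0 of the acting family is nontrivial. Thus one intertwining
  computation, \<open>F_act\<close>, covers both the right action and left multiplication.\<close>

lemma left_mult_eq_act:
  "invertible h \<Longrightarrow> left_mult n h c = act n c ((\<lambda>_. mat 1)(0 := matrix_inv h))"
  by (rule ext)
    (auto simp: left_mult_def act_def matrix_inv_mat_1 matrix_inv_matrix_inv)

lemma bs_class_cong:
  "(\<And>i. i \<in> {1..n} \<Longrightarrow> c i = c' i) \<Longrightarrow> bs_class D n c = bs_class D n c'"
proof -
  assume "\<And>i. i \<in> {1..n} \<Longrightarrow> c i = c' i"
  then have "right_act n c = right_act n c'"
    by (auto simp: right_act_def fun_eq_iff)
  then show ?thesis
    by (simp add: bs_class_def)
qed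

text \<open>Since k 0 = 1, acting by k and then by l is acting by the products k i ** l i, and l
  \<mapsto> k l is a bijection on families in K.\<close>

lemma bs_class_act_normalized:
  assumes k: "\<And>i. i \<le> n \<Longrightarrow> k i \<in> K" and k0: "k 0 = mat 1"
  shows "bs_class D n (act n c k) = bs_class D n c"
proof -
  have comp: "right_act n (act n c k) l = right_act n c (\<lambda>i\<in>{1..n}. k i ** l i)"
    if l: "\<And>i. i \<in> {1..n} \<Longrightarrow> l i \<in> K" for l
  proof
    fix i
    consider "i \<notin> {1..n}" | "i \<in> {1..n}" "i = 1" | "i \<in> {1..n}" "i - 1 \<in> {1..n}" "i \<noteq> 1"
      by force
    then show "right_act n (act n c k) l i = right_act n c (\<lambda>i\<in>{1..n}. k i ** l i) i"
    proof cases
      case 3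
      then have "matrix_inv (k (i - 1) ** l (i - 1)) = matrix_inv (l (i - 1)) ** matrix_inv (k (i - 1))"
        using k l by (intro matrix_inv_mult K_invertible) auto
      with 3 show ?thesis
        by (auto simp: right_act_def act_def matrix_mul_assoc)
    qed (auto simp: right_act_def act_def matrix_mul_assoc k0 matrix_inv_mat_1)
  qed
  show ?thesis
  proof (intro equalityI subsetI)
    fix y assume "y \<in> bs_class D n (act n c k)"
    then obtain l where l: "l \<in> (\<Pi>\<^sub>E i\<in>{1..n}. K)" "y = right_act n (act n c k) l"
      by (auto simp: bs_class_def)
    then have "y = right_act n c (\<lambda>i\<in>{1..n}. k i ** l i)"
      using comp by blast
    moreover have "(\<lambda>i\<in>{1..n}. k i ** l i) \<in> (\<Pi>\<^sub>E i\<in>{1..n}. K)"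
      using l k by (auto intro!: K_mult)
    ultimately show "y \<in> bs_class D n c"
      by (auto simp: bs_class_def)
  next
    fix y assume "y \<in> bs_class D n c"
    then obtain l where l: "l \<in> (\<Pi>\<^sub>E i\<in>{1..n}. K)" "y = right_act n c l"
      by (auto simp: bs_class_def)
    let ?l = "\<lambda>i\<in>{1..n}. matrix_inv (k i) ** l i"
    have l': "?l \<in> (\<Pi>\<^sub>E i\<in>{1..n}. K)"
      using l k by (auto intro!: K_mult K_inv)
    have "(\<lambda>i\<in>{1..n}. k i ** ?l i) i = l i" for i
    proof (cases "i \<in> {1..n}")
      case True
      then have "invertible (k i)"
        using k K_invertible by simp
      with True show ?thesis
        by simp
    next
      case False
      then show ?thesis
        using PiE_arb [OF l(1) False] False by (auto simp: restrict_def)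
    qed
    then have "(\<lambda>i\<in>{1..n}. k i ** ?l i) = l"
      by blast
    moreover have "?l i \<in> K" if "i \<in> {1..n}" for i
      using l' that by (rule PiE_mem)
    ultimately have "right_act n (act n c k) ?l = y"
      using comp [of ?l] l(2) by simp
    with l' show "y \<in> bs_class D n (act n c k)"
      unfolding bs_class_def by blast
  qed
qed

text \<open>Replacing k 0 by 1 moves the factor \<open>matrix_inv (k 0)\<close> into a left
  multiplication of the first entry.\<close>

lemma bs_class_act:
  assumes k: "\<And>i. i \<le> n \<Longrightarrow> k i \<in> K"
  shows "bs_class D n (act n c k) = bs_class D n (left_mult n (matrix_inv (k 0)) c)"
proof -
  have "act n c k = act n (left_mult n (matrix_inv (k 0)) c) (k(0 := mat 1))"
    by (rule ext) (auto simp: act_def left_mult_def matrix_inv_mat_1)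
  then show ?thesis
    using bs_class_act_normalized [of n "k(0 := mat 1)"] k K_one by simp
qed

primrec partial_prod :: "(nat \<Rightarrow> 'n cmat) \<Rightarrow> nat \<Rightarrow> 'n cmat" where
  "partial_prod c 0 = mat 1"
| "partial_prod c (Suc j) = partial_prod c j ** c (Suc j)"

lemma lies_partial_prod:
  assumes "\<And>i. i \<in> {1..n} \<Longrightarrow> lies (c i) (u i)" "j \<le> n"
  shows "lies (partial_prod c j) (gal_prod D u j)"
  using assms(2)
proof (induction j)
  case 0
  then show ?case using lies_id_iff K_one by (simp add: id_def)
next
  case (Suc j)
  then have "lies (partial_prod c j) (gal_prod D u j)" "lies (c (Suc j)) (u (Suc j))"
    using assms(1) by auto
  from lies_mult [OF this] show ?case
    by (simp add: lies_W [OF \<open>lies (partial_prod c j) _\<close>] lies_W [OF \<open>lies (c (Suc j)) _\<close>] comp_def)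
qed

text \<open>The partial products of c and c' lie over the same Weyl group elements, so their
  quotients k j are in K, and this family carries c to c'. In particular a gallery point does not
  depend on the representatives.\<close>

lemma bs_class_lies_eq:
  assumes c: "\<And>i. i \<in> {1..n} \<Longrightarrow> lies (c i) (u i)"
    and c': "\<And>i. i \<in> {1..n} \<Longrightarrow> lies (c' i) (u i)"
  shows "bs_class D n c = bs_class D n c'"
proof -
  define k where "k j = matrix_inv (partial_prod c j) ** partial_prod c' j" for j
  have l: "lies (partial_prod c j) (gal_prod D u j)" "lies (partial_prod c' j) (gal_prod D u j)"
    if "j \<le> n" for j
    using lies_partial_prod that c c' by blast+
  have "act n c k i = c' i" if "i \<in> {1..n}" for i
  proof -
    from that obtain j where i: "i = Suc j"
      by (cases i) auto
    have inv: "invertible (partial_prod c j)" "invertible (partial_prod c' j)"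
        "invertible (partial_prod c (Suc j))"
      using l [of j] l [of "Suc j"] that i lies_invertible by auto
    have "matrix_inv (k j) = matrix_inv (partial_prod c' j) ** partial_prod c j"
      unfolding k_def using inv
      by (intro matrix_inv_unique) (simp_all add: matrix_inv_left matrix_inv_right flip: matrix_mul_assoc)
    then have "act n c k i = matrix_inv (partial_prod c' j) ** (partial_prod c (Suc j) **
        (matrix_inv (partial_prod c (Suc j)) ** partial_prod c' (Suc j)))"
      using that by (simp add: act_def i k_def matrix_mul_assoc)
    also have "\<dots> = c' i"
      using inv by (simp only: invertible_cancel) (simp add: i)
    finally show ?thesis .
  qed
  moreover have "k i \<in> K" if "i \<le> n" for i
    unfolding k_def using lies_unique l [OF that] by blast
  moreover have "k 0 = mat 1"
    by (simp add: k_def matrix_inv_mat_1)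
  ultimately show ?thesis
    using bs_class_act_normalized [of n k c] bs_class_cong by metis
qed

lemma bs_class_self:
  assumes "c \<in> C_seq D n s"
  shows "c \<in> bs_class D n c"
proof -
  have "right_act n c (\<lambda>i\<in>{1..n}. mat 1) = c"
    using assms by (auto simp: C_seq_def right_act_def fun_eq_iff matrix_inv_mat_1 PiE_iff extensional_def)
  then show ?thesis
    unfolding bs_class_def using K_one by (intro image_eqI [of _ _ "\<lambda>i\<in>{1..n}. mat 1"]) auto
qed

end

section \<open>The map induced by a folding morphism\<close>

locale folding = compact_chev D H \<iota>
  for D :: "('e::euclidean_space, 'n::finite) chev" and H \<iota> +
  fixes n n' :: nat and s s' :: "nat \<Rightarrow> 'e \<Rightarrow> 'e" and p :: "nat \<Rightarrow> nat" and w :: "'e \<Rightarrow> 'e"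
    and \<phi> :: "(nat \<Rightarrow> 'e \<Rightarrow> 'e) \<Rightarrow> nat \<Rightarrow> 'e \<Rightarrow> 'e"
  assumes s: "\<And>i. i \<in> {1..n} \<Longrightarrow> s i \<in> reflection ` \<Delta>"
    and s': "\<And>i. i \<in> {1..n'} \<Longrightarrow> s' i \<in> reflection ` \<Delta>"
    and morphism: "folding_morphism D n s n' s' p w \<phi>"
begin

section \<open>The base gallery and the reindexing by p\<close>

lemma w_W: "w \<in> W"
  using morphism by (simp add: folding_morphism_def)

lemma p_range: "i \<in> {1..n} \<Longrightarrow> p i \<in> {1..n'}"
  and p_less_iff: "i \<in> {1..n} \<Longrightarrow> j \<in> {1..n} \<Longrightarrow> p i < p j \<longleftrightarrow> i < j"
  using morphism strict_mono_on_less [of "{1..n}" p] by (auto simp: folding_morphism_def)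

lemma s_root: "i \<in> {1..n} \<Longrightarrow> \<exists>\<alpha>\<in>\<Phi>. s i = reflection \<alpha>"
  and s'_root: "i \<in> {1..n'} \<Longrightarrow> \<exists>\<alpha>\<in>\<Phi>. s' i = reflection \<alpha>"
  using s s' simple_roots_subset by blast+

lemma s_W: "i \<in> {1..n} \<Longrightarrow> s i \<in> W"
  and s'_W: "i \<in> {1..n'} \<Longrightarrow> s' i \<in> W"
  using s_root s'_root reflection_in_W by metis+

lemma s'_s': "i \<in> {1..n'} \<Longrightarrow> s' i \<circ> s' i = id"
  using s'_root [of i] by (auto simp: fun_eq_iff reflection_reflection root_nz)

definition base :: "nat \<Rightarrow> 'e \<Rightarrow> 'e" where
  "base = (\<lambda>i\<in>{1..n}. id)"

definition \<delta> :: "nat \<Rightarrow> 'e \<Rightarrow> 'e" where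
  "\<delta> = \<phi> base"

lemma base_gallery: "base \<in> galleries D n s"
  by (auto simp: base_def galleries_def id_def)

lemma \<delta>_gallery: "\<delta> \<in> galleries D n' s'"
  using morphism base_gallery by (auto simp: folding_morphism_def \<delta>_def)

lemma \<delta>_cases: "j \<in> {1..n'} \<Longrightarrow> \<delta> j = id \<or> \<delta> j = s' j"
  using \<delta>_gallery by (auto simp: galleries_def PiE_iff)

lemma \<delta>_W: "j \<in> {1..n'} \<Longrightarrow> \<delta> j \<in> W"
  using \<delta>_cases [of j] s'_W [of j] W.one_closed by (auto simp: id_def)

text \<open>A left inverse of p that is constant between consecutive values of p. It selects which k
  i governs position j of the target, and it is defined at j = 0 as well.\<close>

definition q :: "nat \<Rightarrow> nat" where
  "q j = card {i \<in> {1..n}. p i \<le> j}"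

lemma q_le: "q j \<le> n"
proof -
  have "card {i \<in> {1..n}. p i \<le> j} \<le> card {1..n}"
    by (intro card_mono) auto
  then show ?thesis
    by (simp add: q_def)
qed

lemma q_0: "q 0 = 0"
  using p_range by (force simp: q_def)

lemma q_p: "i \<in> {1..n} \<Longrightarrow> q (p i) = i"
proof -
  assume i: "i \<in> {1..n}"
  have "p j \<le> p i \<longleftrightarrow> j \<le> i" if "j \<in> {1..n}" for j
    using p_less_iff [OF i that] by (simp add: linorder_not_less [symmetric])
  with i have "{j \<in> {1..n}. p j \<le> p i} = {1..i}"
    by auto
  then show ?thesis
    by (simp add: q_def)
qed

lemma q_p_minus: "i \<in> {1..n} \<Longrightarrow> q (p i - 1) = i - 1"
proof -
  assume i: "i \<in> {1..n}"
  have "p j \<le> p i - 1 \<longleftrightarrow> p j < p i" for j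
    using p_range [OF i] by auto
  then have "{j \<in> {1..n}. p j \<le> p i - 1} = {1..i - 1}"
    using p_less_iff [OF _ i] i by auto
  then show ?thesis
    by (simp add: q_def)
qed

lemma q_minus: "j \<notin> p ` {1..n} \<Longrightarrow> q (j - 1) = q j"
proof -
  assume "j \<notin> p ` {1..n}"
  then have "{i \<in> {1..n}. p i \<le> j - 1} = {i \<in> {1..n}. p i \<le> j}"
    by (auto simp: le_less)
  then show ?thesis
    by (simp add: q_def)
qed

section \<open>Representatives along the gallery \<delta>\<close>

lemma gal_prod_\<delta>_W: "j \<le> n' \<Longrightarrow> gal_prod D \<delta> j \<in> W"
  by (induction j) (use \<delta>_W W.one_closed in \<open>auto simp del: W_mult W_one\<close>)

definition g :: "'n cmat" where
  "g = rep D w"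

lemma lies_g: "lies g w"
  by (simp add: g_def lies_rep w_W)

lemma invertible_g: "invertible g"
  using lies_g lies_invertible by blast

definition m :: "nat \<Rightarrow> 'n cmat" where
  "m j = matrix_inv g ** partial_prod (\<lambda>j. rep D (\<delta> j)) j"

definition u :: "nat \<Rightarrow> 'e \<Rightarrow> 'e" where
  "u j = inv\<^bsub>weyl D\<^esub> w \<otimes>\<^bsub>weyl D\<^esub> gal_prod D \<delta> j"

lemma u_W: "j \<le> n' \<Longrightarrow> u j \<in> W"
  unfolding u_def by (intro W.m_closed W.inv_closed w_W gal_prod_\<delta>_W)

lemma lies_m: "j \<le> n' \<Longrightarrow> lies (m j) (u j)"
  using lies_mult [OF lies_matrix_inv [OF lies_g]
      lies_partial_prod [of n' "\<lambda>j. rep D (\<delta> j)" \<delta>, OF lies_rep [OF \<delta>_W]], of j]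
  by (simp add: m_def u_def w_W gal_prod_\<delta>_W)

lemma lies_m_pred: "j \<in> {1..n'} \<Longrightarrow> lies (m (j - 1)) (u (j - 1))"
  by (rule lies_m) auto

lemma m_0: "m 0 = matrix_inv g"
  by (simp add: m_def)

lemma m_step: "j \<in> {1..n'} \<Longrightarrow> m j = m (j - 1) ** rep D (\<delta> j)"
  by (cases j) (simp_all add: m_def matrix_mul_assoc)

lemma u_step: "j \<in> {1..n'} \<Longrightarrow> u j = u (j - 1) \<circ> \<delta> j"
proof -
  assume j: "j \<in> {1..n'}"
  then obtain i where i: "j = Suc i" "i \<le> n'"
    by (cases j) auto
  have "u j = u i \<otimes>\<^bsub>weyl D\<^esub> \<delta> j"
    using gal_prod_\<delta>_W [OF i(2)] \<delta>_W [OF j] w_W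
    by (simp add: u_def i(1) W.m_assoc del: W_mult)
  then show ?thesis
    using u_W [OF i(2)] \<delta>_W [OF j] by (simp add: i(1))
qed

text \<open>At the base gallery, whose partial products are 1, the first morphism condition says
  that u (p i) conjugates s' (p i) into s i. The same holds one index earlier because \<delta> (p i)
  is 1 or s' (p i) and so commutes with s' (p i).\<close>

lemma u_conj:
  assumes i: "i \<in> {1..n}"
  shows "u (p i - 1) \<circ> s' (p i) = s i \<circ> u (p i - 1)"
proof -
  let ?j = "p i"
  let ?dl = "gal_prod D \<delta> ?j"
  note j = p_range [OF i]
  have dl: "?dl \<in> W"
    using gal_prod_\<delta>_W j by simp
  have base_one: "gal_prod D base k = \<one>\<^bsub>weyl D\<^esub>" if "k \<le> n" for k
    using that
  proof (induction k)
    case (Suc k)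
    then have "base (Suc k) = \<one>\<^bsub>weyl D\<^esub>"
      by (simp add: base_def)
    then show ?case
      using Suc by (simp del: W_one W_mult)
  qed simp
  have "?dl \<otimes>\<^bsub>weyl D\<^esub> s' ?j \<otimes>\<^bsub>weyl D\<^esub> inv\<^bsub>weyl D\<^esub> ?dl
      = w \<otimes>\<^bsub>weyl D\<^esub> gal_prod D base i \<otimes>\<^bsub>weyl D\<^esub> s i \<otimes>\<^bsub>weyl D\<^esub> inv\<^bsub>weyl D\<^esub> gal_prod D base i \<otimes>\<^bsub>weyl D\<^esub> inv\<^bsub>weyl D\<^esub> w"
    using morphism base_gallery i unfolding folding_morphism_def \<delta>_def by blast
  also have "gal_prod D base i = \<one>\<^bsub>weyl D\<^esub>"
    using base_one i by simp
  finally have conj: "?dl \<otimes>\<^bsub>weyl D\<^esub> s' ?j \<otimes>\<^bsub>weyl D\<^esub> inv\<^bsub>weyl D\<^esub> ?dl = w \<otimes>\<^bsub>weyl D\<^esub> s i \<otimes>\<^bsub>weyl D\<^esub> inv\<^bsub>weyl D\<^esub> w"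
    using w_W s_W [OF i] by (simp del: W_mult W_one)
  have "u ?j \<otimes>\<^bsub>weyl D\<^esub> s' ?j = inv\<^bsub>weyl D\<^esub> w \<otimes>\<^bsub>weyl D\<^esub>
      (?dl \<otimes>\<^bsub>weyl D\<^esub> s' ?j \<otimes>\<^bsub>weyl D\<^esub> inv\<^bsub>weyl D\<^esub> ?dl) \<otimes>\<^bsub>weyl D\<^esub> ?dl"
    unfolding u_def using w_W dl s'_W [OF j] by (simp add: W.m_assoc del: W_mult W_one)
  also have "\<dots> = inv\<^bsub>weyl D\<^esub> w \<otimes>\<^bsub>weyl D\<^esub> (w \<otimes>\<^bsub>weyl D\<^esub> (s i \<otimes>\<^bsub>weyl D\<^esub> u ?j))"
    unfolding conj u_def using w_W dl s_W [OF i] by (simp add: W.m_assoc del: W_mult W_one)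
  also have "\<dots> = s i \<otimes>\<^bsub>weyl D\<^esub> u ?j"
    using w_W s_W [OF i] u_W [of ?j] j by (simp add: W.m_assoc [symmetric] del: W_mult W_one)
  finally have "u ?j \<circ> s' ?j = s i \<circ> u ?j"
    using u_W [of ?j] s'_W s_W i j by simp
  then have e: "u (?j - 1) \<circ> (\<delta> ?j \<circ> s' ?j) = s i \<circ> (u (?j - 1) \<circ> \<delta> ?j)"
    using u_step [OF j] by (simp add: comp_assoc)
  show ?thesis
  proof (cases "\<delta> ?j = id")
    case True
    with e show ?thesis by simp
  next
    case False
    then have "\<delta> ?j = s' ?j"
      using \<delta>_cases [OF j] by simp
    with e have "u (?j - 1) = s i \<circ> (u (?j - 1) \<circ> s' ?j)"
      by (simp add: s'_s' [OF j])
    then have "u (?j - 1) \<circ> s' ?j = s i \<circ> u (?j - 1) \<circ> (s' ?j \<circ> s' ?j)"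
      by (metis comp_assoc)
    then show ?thesis
      by (simp add: s'_s' [OF j])
  qed
qed

section \<open>The map on sequences\<close>

definition F :: "(nat \<Rightarrow> 'n cmat) \<Rightarrow> nat \<Rightarrow> 'n cmat" where
  "F c = (\<lambda>j\<in>{1..n'}. matrix_inv (m (j - 1)) ** (if j \<in> p ` {1..n} then c (q j) else mat 1) ** m j)"

text \<open>Adjacent factors m cancel. At j = p i the indices q (j - 1) and q j are i - 1 and i,
  matching the two factors around c i.\<close>

lemma F_act:
  assumes k: "\<And>i. i \<le> n \<Longrightarrow> invertible (k i)"
  shows "F (act n c k) = act n' (F c) (\<lambda>j. matrix_inv (m j) ** k (q j) ** m j)"
proof
  fix j
  define kt where "kt j = matrix_inv (m j) ** k (q j) ** m j" for j
  show "F (act n c k) j = act n' (F c) (\<lambda>j. matrix_inv (m j) ** k (q j) ** m j) j"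
  proof (cases "j \<in> {1..n'}")
    case True
    have im: "invertible (m (j - 1))" "invertible (m j)"
      using lies_m [of j] lies_m_pred [OF True] lies_invertible True by auto
    have ik: "invertible (k (q (j - 1)))" "invertible (k (q j))"
      using k q_le by auto
    have kt: "matrix_inv (kt (j - 1)) = matrix_inv (m (j - 1)) ** matrix_inv (k (q (j - 1))) ** m (j - 1)"
      unfolding kt_def using im ik
      by (intro matrix_inv_unique) (simp_all add: matrix_inv_left matrix_inv_right flip: matrix_mul_assoc)
    let ?c = "\<lambda>c. if j \<in> p ` {1..n} then c (q j) else mat 1 :: 'n cmat"
    have "?c (act n c k) = matrix_inv (k (q (j - 1))) ** ?c c ** k (q j)"
    proof (cases "j \<in> p ` {1..n}")
      case True
      then obtain i where "i \<in> {1..n}" "j = p i"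
        by blast
      then show ?thesis
        using q_p q_p_minus by (simp add: act_def)
    next
      \<comment> \<open>Outside the image of p the index q does not change, so the two factors k
        cancel around the entry 1.\<close>
      case False
      then show ?thesis
        using q_minus ik by (simp add: matrix_inv_left)
    qed
    then have "F (act n c k) j
        = matrix_inv (m (j - 1)) ** (matrix_inv (k (q (j - 1))) ** ?c c ** k (q j)) ** m j"
      using True by (simp add: F_def)
    also have "\<dots> = matrix_inv (kt (j - 1)) ** F c j ** kt j"
      unfolding kt kt_def [of j] using True im by (simp add: F_def flip: matrix_mul_assoc)
    finally show ?thesis
      using True by (simp add: act_def kt_def)
  next
    case False
    then show ?thesis
      by (simp only: F_def act_def restrict_apply if_False)
  qed
qed

lemma F_off: "j \<in> {1..n'} \<Longrightarrow> j \<notin> p ` {1..n} \<Longrightarrow> F c j = rep D (\<delta> j)"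
  using lies_invertible [OF lies_m_pred [of j]] by (simp add: F_def m_step)

text \<open>This form separates a pure conjugation, to which \<open>C_refl_conj\<close> applies,
  from a factor covered by \<open>C_refl_mult_rep\<close>.\<close>

lemma F_on: "i \<in> {1..n} \<Longrightarrow> F c (p i) = matrix_inv (m (p i - 1)) ** c i ** m (p i - 1) ** rep D (\<delta> (p i))"
  using p_range [of i] q_p [of i] m_step [of "p i"] by (simp add: F_def matrix_mul_assoc)

lemma rep_in_C_refl:
  "j \<in> {1..n'} \<Longrightarrow> v = id \<or> v = s' j \<Longrightarrow> rep D v \<in> C_refl D (s' j)"
  using s'_root [of j] C_refl_mult_rep [OF one_in_C_refl] by force

lemma F_in_C_refl:
  assumes "c \<in> C_seq D n s" "j \<in> {1..n'}"
  shows "F c j \<in> C_refl D (s' j)"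
proof (cases "j \<in> p ` {1..n}")
  case True
  then obtain i where i: "i \<in> {1..n}" "j = p i"
    by blast
  let ?m = "m (j - 1)" and ?u = "u (j - 1)"
  have l: "lies ?m ?u"
    by (rule lies_m_pred [OF assms(2)])
  have inv: "?u ((inv\<^bsub>weyl D\<^esub> ?u) y) = y" "(inv\<^bsub>weyl D\<^esub> ?u) (?u y) = y" for y
  proof -
    have "?u \<in> W"
      using l lies_W by blast
    then have "?u \<circ> inv\<^bsub>weyl D\<^esub> ?u = id" "inv\<^bsub>weyl D\<^esub> ?u \<circ> ?u = id"
      using W.r_inv [of ?u] W.l_inv [of ?u] by simp_all
    then show "?u ((inv\<^bsub>weyl D\<^esub> ?u) y) = y" "(inv\<^bsub>weyl D\<^esub> ?u) (?u y) = y"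
      by (metis comp_apply id_apply)+
  qed
  \<comment> \<open>This is \<open>u_conj\<close> in the pointwise form that
    \<open>C_refl_conj\<close> requires for the inverse of \<open>?u\<close>.\<close>
  have "s' j ((inv\<^bsub>weyl D\<^esub> ?u) y) = (inv\<^bsub>weyl D\<^esub> ?u) (s i y)" for y
    using u_conj [OF i(1)] unfolding i(2) [symmetric] by (metis comp_apply inv)
  moreover have "c i \<in> C_refl D (s i)"
    using assms(1) i(1) by (auto simp: C_seq_def)
  ultimately have "matrix_inv ?m ** c i ** matrix_inv (matrix_inv ?m) \<in> C_refl D (s' j)"
    by (intro C_refl_conj [OF lies_matrix_inv [OF l]])
  then have "matrix_inv ?m ** c i ** ?m \<in> C_refl D (s' j)"
    using lies_invertible [OF l] by (simp add: matrix_inv_matrix_inv)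
  then show ?thesis
    using C_refl_mult_rep \<delta>_cases [OF assms(2)] F_on [OF i(1)] i(2) by metis
next
  case False
  then show ?thesis
    using F_off rep_in_C_refl \<delta>_cases assms(2) by metis
qed

lemma F_C_seq: "c \<in> C_seq D n s \<Longrightarrow> F c \<in> C_seq D n' s'"
  using F_in_C_refl by (auto simp: C_seq_def F_def PiE_iff)

text \<open>Each coordinate is constant or a coordinate projection followed by multiplication with
  fixed matrices.\<close>

lemma continuous_map_F: "continuous_map (C_top D n s) (C_top D n' s') F"
  unfolding C_top_def [of D n'] continuous_map_componentwise
proof (intro conjI ballI)
  show "F ` topspace (C_top D n s) \<subseteq> extensional {1..n'}"
    by (auto simp: F_def)
next
  fix j assume j: "j \<in> {1..n'}"
  have "continuous_map (C_top D n s) euclidean (\<lambda>c. F c j)"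
  proof (cases "j \<in> p ` {1..n}")
    case True
    then obtain i where i: "i \<in> {1..n}" "j = p i"
      by blast
    have "continuous_map (C_top D n s) (top_of_set (C_refl D (s i))) (\<lambda>c. c i)"
      unfolding C_top_def by (rule continuous_map_product_projection [OF i(1)])
    then have pr: "continuous_map (C_top D n s) euclidean (\<lambda>c. c i)"
      by (rule continuous_map_into_fulltopology)
    have "continuous_on UNIV (\<lambda>A. matrix_inv (m (j - 1)) ** A ** m j)"
      by (intro mm.continuous_on continuous_intros)
    then have "continuous_map euclidean euclidean (\<lambda>A. matrix_inv (m (j - 1)) ** A ** m j)"
      by (simp add: continuous_map_iff_continuous2)
    from continuous_map_compose [OF pr this] show ?thesis
      using i j q_p by (simp add: F_def o_def)
  next
    case False
    then show ?thesis
      using j by (simp add: F_def)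
  qed
  then show "continuous_map (C_top D n s) (top_of_set (C_refl D (s' j))) (\<lambda>c. F c j)"
    using F_in_C_refl [OF _ j] by (simp add: continuous_map_in_subtopology topspace_C_top image_subset_iff)
qed

lemma bs_class_F:
  assumes "c \<in> C_seq D n s" "bs_class D n c = bs_class D n c'"
  shows "bs_class D n' (F c) = bs_class D n' (F c')"
proof -
  have "c \<in> bs_class D n c'"
    using bs_class_self [OF assms(1)] assms(2) by simp
  then obtain k where k: "k \<in> (\<Pi>\<^sub>E i\<in>{1..n}. K)" "c = right_act n c' k"
    by (auto simp: bs_class_def)
  let ?k = "k(0 := mat 1)"
  have kK: "?k i \<in> K" if "i \<le> n" for i
    using k(1) that K_one by (auto simp: PiE_iff)
  have "F c = act n' (F c') (\<lambda>j. matrix_inv (m j) ** ?k (q j) ** m j)"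
    unfolding k(2) right_act_eq_act using kK K_invertible by (intro F_act) blast
  moreover have "matrix_inv (m j) ** ?k (q j) ** m j \<in> K" if "j \<le> n'" for j
    using conj_K' [OF lies_m [OF that] kK [OF q_le]] .
  \<comment> \<open>As q 0 = 0 and \<open>?k 0\<close> is 1, the transported family is again
    normalized at 0 and so does not change the class.\<close>
  moreover have "matrix_inv (m 0) ** ?k (q 0) ** m 0 = mat 1"
    using lies_invertible [OF lies_m [of 0]] by (simp add: q_0 matrix_inv_left)
  ultimately show ?thesis
    using bs_class_act_normalized [of n' "\<lambda>j. matrix_inv (m j) ** ?k (q j) ** m j" "F c'"]
    by (simp only:)
qed

lemma left_mult_C_seq:
  assumes "k \<in> K" "c \<in> C_seq D n s"
  shows "left_mult n k c \<in> C_seq D n s"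
  using assms by (auto simp: C_seq_def left_mult_def PiE_iff intro!: K_mult_C_refl)

lemma bs_class_F_left_mult:
  assumes k: "k \<in> K"
  shows "bs_class D n' (F (left_mult n k c)) = bs_class D n' (left_mult n' (g ** k ** matrix_inv g) (F c))"
proof -
  let ?k = "(\<lambda>_ :: nat. mat 1)(0 := matrix_inv k)"
  have kK: "?k i \<in> K" for i
    using k K_one K_inv by simp
  have "F (left_mult n k c) = act n' (F c) (\<lambda>j. matrix_inv (m j) ** ?k (q j) ** m j)"
    unfolding left_mult_eq_act [OF K_invertible [OF k]] using kK K_invertible by (intro F_act) blast
  moreover have "matrix_inv (m j) ** ?k (q j) ** m j \<in> K" if "j \<le> n'" for j
    using conj_K' [OF lies_m [OF that] kK] .
  \<comment> \<open>Here m 0 is the inverse of g and \<open>?k (q 0)\<close> the inverse of k, so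
    the left factor supplied by \<open>bs_class_act\<close> is the conjugate of k by g.\<close>
  moreover have "matrix_inv (matrix_inv (m 0) ** ?k (q 0) ** m 0) = g ** k ** matrix_inv g"
    using invertible_g K_invertible [OF k]
    by (intro matrix_inv_unique)
      (simp_all add: q_0 m_0 matrix_inv_matrix_inv matrix_inv_left matrix_inv_right flip: matrix_mul_assoc)
  ultimately show ?thesis
    using bs_class_act [of n' "\<lambda>j. matrix_inv (m j) ** ?k (q j) ** m j" "F c"] by simp
qed

text \<open>
  Every gallery is obtained from \<^const>\<open>base\<close> by folding successively at the places where it is
  not \<open>1\<close>.
\<close>
lemma \<phi>_eq:
  assumes \<gamma>: "\<gamma> \<in> galleries D n s" and j: "j \<in> {1..n'}"
  shows "\<phi> \<gamma> j = (if j \<in> p ` {1..n} \<and> \<gamma> (q j) \<noteq> id then \<delta> j \<circ> s' j else \<delta> j)"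
proof -
  \<comment> \<open>The gallery agreeing with \<gamma> up to k and equal to 1 beyond; passing from k
    to k + 1 is at most one fold.\<close>
  define \<gamma>' where "\<gamma>' k = (\<lambda>i\<in>{1..n}. if i \<le> k then \<gamma> i else id)" for k
  have \<gamma>_cases: "\<gamma> i = id \<or> \<gamma> i = s i" if "i \<in> {1..n}" for i
    using \<gamma> that by (auto simp: galleries_def PiE_iff)
  have gal: "\<gamma>' k \<in> galleries D n s" for k
    using \<gamma>_cases unfolding galleries_def \<gamma>'_def W_one by auto
  define E where "E k j = (if j \<in> p ` {1..n} \<and> q j \<le> k \<and> \<gamma> (q j) \<noteq> id then \<delta> j \<circ> s' j else \<delta> j)"
    for k j
  have "\<forall>j\<in>{1..n'}. \<phi> (\<gamma>' k) j = E k j" if "k \<le> n" for k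
    using that
  proof (induction k)
    case 0
    have "\<gamma>' 0 = base"
      by (auto simp: \<gamma>'_def base_def fun_eq_iff)
    then have "\<phi> (\<gamma>' 0) = \<delta>"
      by (simp add: \<delta>_def)
    moreover have "E 0 j = \<delta> j" for j
      using q_p by (auto simp: E_def)
    ultimately show ?case
      by simp
  next
    case (Suc k)
    then have k: "Suc k \<in> {1..n}"
      by simp
    note pk = p_range [OF k]
    show ?case
    proof (cases "\<gamma> (Suc k) = id")
      case True
      have "\<gamma>' (Suc k) = \<gamma>' k"
        using True by (auto simp: \<gamma>'_def fun_eq_iff le_Suc_eq)
      moreover have "E (Suc k) j = E k j" for j
        using True by (auto simp: E_def le_Suc_eq)
      ultimately show ?thesis
        using Suc.IH k by simp
    next
      case False
      then have sk: "\<gamma> (Suc k) = s (Suc k)"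
        using \<gamma>_cases [OF k] by simp
      have "\<one>\<^bsub>weyl D\<^esub> \<otimes>\<^bsub>weyl D\<^esub> s (Suc k) = s (Suc k)"
        using s_W [OF k] by (rule W.l_one)
      then have "\<gamma>' (Suc k) = fold_at D s (Suc k) (\<gamma>' k)"
        using k sk by (auto simp: \<gamma>'_def fold_at_def fun_eq_iff le_Suc_eq)
      then have \<phi>: "\<phi> (\<gamma>' (Suc k)) = fold_at D s' (p (Suc k)) (\<phi> (\<gamma>' k))"
        using morphism gal k unfolding folding_morphism_def by metis
      show ?thesis
      proof
        fix j assume j: "j \<in> {1..n'}"
        show "\<phi> (\<gamma>' (Suc k)) j = E (Suc k) j"
        proof (cases "j = p (Suc k)")
          case True
          \<comment> \<open>Since q (p (Suc k)) = Suc k exceeds k, this position has not been folded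
            yet.\<close>
          have "\<phi> (\<gamma>' k) j = \<delta> j"
            using Suc j q_p [OF k] by (simp add: True E_def)
          then have "\<phi> (\<gamma>' (Suc k)) j = \<delta> j \<circ> s' j"
            using \<delta>_W [OF j] s'_W [OF j] by (simp add: \<phi> fold_at_def True)
          then show ?thesis
            using True q_p [OF k] k False by (auto simp: E_def)
        next
          case ne: False
          then have "q j \<noteq> Suc k" if "j \<in> p ` {1..n}"
            using that q_p by auto
          then show ?thesis
            using Suc j ne by (auto simp: \<phi> fold_at_def E_def le_Suc_eq)
        qed
      qed
    qed
  qed
  moreover have "\<gamma>' n = \<gamma>"
    using \<gamma> by (auto simp: \<gamma>'_def galleries_def fun_eq_iff PiE_iff extensional_def)
  ultimately have "\<phi> \<gamma> j = E n j"
    using j by force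
  then show ?thesis
    using q_le by (simp add: E_def)
qed

lemma rep_gallery_C_seq:
  assumes "\<gamma> \<in> galleries D n s"
  shows "(\<lambda>i\<in>{1..n}. rep D (\<gamma> i)) \<in> C_seq D n s"
proof -
  have "rep D (\<gamma> i) \<in> C_refl D (s i)" if i: "i \<in> {1..n}" for i
  proof -
    have "\<gamma> i = id \<or> \<gamma> i = s i"
      using assms i by (auto simp: galleries_def PiE_iff)
    then show ?thesis
      using s_root [OF i] C_refl_mult_rep [OF one_in_C_refl] by force
  qed
  then show ?thesis
    by (auto simp: C_seq_def)
qed

text \<open>At j = p i the entry lies over u^-1 \<gamma>_i u \<delta>_j with u = u (j - 1). By
  \<open>u_conj\<close> this is \<delta>_j or s'_j \<delta>_j, matching \<open>\<phi>_eq\<close>;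
  \<open>bs_class_lies_eq\<close> absorbs the discrepancy from the chosen representatives.\<close>

lemma F_gallery:
  assumes \<gamma>: "\<gamma> \<in> galleries D n s"
  shows "bs_class D n' (F (\<lambda>i\<in>{1..n}. rep D (\<gamma> i))) = gal_point D n' (\<phi> \<gamma>)"
proof -
  let ?c = "\<lambda>i\<in>{1..n}. rep D (\<gamma> i)"
  have \<gamma>_cases: "\<gamma> i = id \<or> \<gamma> i = s i" if "i \<in> {1..n}" for i
    using \<gamma> that by (auto simp: galleries_def PiE_iff)
  have "\<phi> \<gamma> \<in> galleries D n' s'"
    using morphism \<gamma> by (auto simp: folding_morphism_def)
  then have \<phi>_W: "\<phi> \<gamma> j \<in> W" if "j \<in> {1..n'}" for j
    using that s'_W [OF that] W.one_closed by (force simp: galleries_def PiE_iff simp del: W_one)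
  have "lies (F ?c j) (\<phi> \<gamma> j)" if j: "j \<in> {1..n'}" for j
  proof (cases "j \<in> p ` {1..n}")
    case False
    then show ?thesis
      using F_off [OF j False] \<phi>_eq [OF \<gamma> j] lies_rep [OF \<delta>_W [OF j]] by simp
  next
    case True
    then obtain i where i: "i \<in> {1..n}" "j = p i"
      by blast
    let ?u = "u (j - 1)"
    have l: "lies (m (j - 1)) ?u"
      by (rule lies_m_pred [OF j])
    then have uW: "?u \<in> W"
      by (rule lies_W)
    have \<gamma>W: "\<gamma> i \<in> W"
      using \<gamma>_cases [OF i(1)] s_W [OF i(1)] W.one_closed by (metis W_one)
    have "lies (F ?c j) (inv\<^bsub>weyl D\<^esub> ?u \<circ> \<gamma> i \<circ> ?u \<circ> \<delta> j)"
      unfolding i(2) F_on [OF i(1)] using i l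
      by (intro lies_mult lies_matrix_inv lies_rep \<delta>_W j [unfolded i(2)]) (simp_all add: lies_rep \<gamma>W)
    moreover have "inv\<^bsub>weyl D\<^esub> ?u \<circ> \<gamma> i \<circ> ?u \<circ> \<delta> j = \<phi> \<gamma> j"
    proof -
      have inv: "inv\<^bsub>weyl D\<^esub> ?u \<circ> ?u = id"
        using W.l_inv [OF uW] uW by simp
      show ?thesis
      proof (cases "\<gamma> i = id")
        case True
        then show ?thesis
          using \<phi>_eq [OF \<gamma> j] q_p [OF i(1)] i(2) inv by simp
      next
        case False
        then have "inv\<^bsub>weyl D\<^esub> ?u \<circ> \<gamma> i \<circ> ?u \<circ> \<delta> j = inv\<^bsub>weyl D\<^esub> ?u \<circ> (s i \<circ> ?u) \<circ> \<delta> j"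
          using \<gamma>_cases [OF i(1)] by (simp add: comp_assoc)
        also have "\<dots> = inv\<^bsub>weyl D\<^esub> ?u \<circ> ?u \<circ> s' j \<circ> \<delta> j"
          using u_conj [OF i(1)] i(2) by (simp add: comp_assoc)
        \<comment> \<open>The two factors commute since \<delta> j is 1 or s' j.\<close>
        also have "\<dots> = \<delta> j \<circ> s' j"
          using inv \<delta>_cases [OF j] by auto
        finally show ?thesis
          using \<phi>_eq [OF \<gamma> j] q_p [OF i(1)] i False by auto
      qed
    qed
    ultimately show ?thesis
      by simp
  qed
  then show ?thesis
    unfolding gal_point_def using lies_rep \<phi>_W
    by (intro bs_class_lies_eq [of n' _ "\<phi> \<gamma>"]) auto
qed

section \<open>The induced map on Bott--Samelson spaces\<close>

definition \<psi> :: "(nat \<Rightarrow> 'n cmat) set \<Rightarrow> (nat \<Rightarrow> 'n cmat) set" where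
  "\<psi> a = bs_class D n' (F (SOME c. c \<in> C_seq D n s \<and> bs_class D n c = a))"

lemma \<psi>_bs_class:
  assumes "c \<in> C_seq D n s"
  shows "\<psi> (bs_class D n c) = bs_class D n' (F c)"
proof -
  let ?c = "SOME c'. c' \<in> C_seq D n s \<and> bs_class D n c' = bs_class D n c"
  have "?c \<in> C_seq D n s \<and> bs_class D n ?c = bs_class D n c"
    by (rule someI [of _ c]) (simp add: assms)
  then show ?thesis
    unfolding \<psi>_def using bs_class_F by blast
qed

text \<open>By the universal property of the quotient topology it suffices that the composite with
  the class map, which is \<open>F\<close> followed by the class map, is continuous.\<close>

lemma continuous_map_\<psi>: "continuous_map (BS_top D n s) (BS_top D n' s') \<psi>"
proof (rule continuous_compose_quotient_map [OF quotient_map_bs_class])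
  have "continuous_map (C_top D n s) (BS_top D n' s') (bs_class D n' \<circ> F)"
    by (rule continuous_map_compose [OF continuous_map_F quotient_imp_continuous_map [OF quotient_map_bs_class]])
  then show "continuous_map (C_top D n s) (BS_top D n' s') (\<psi> \<circ> bs_class D n)"
    by (rule continuous_map_eq) (simp add: topspace_C_top \<psi>_bs_class)
qed

lemma \<psi>_left_act:
  assumes "k \<in> K" "a \<in> BS D n s"
  shows "\<psi> (left_act n k a) = left_act n' (g ** k ** matrix_inv g) (\<psi> a)"
proof -
  obtain c where c: "c \<in> C_seq D n s" "a = bs_class D n c"
    using assms(2) by (auto simp: BS_def)
  then show ?thesis
    using assms(1)
    by (simp add: left_act_bs_class \<psi>_bs_class left_mult_C_seq bs_class_F_left_mult)
qed

text \<open>Any h in K is the conjugate by g of an element of K, so equivariance turns invariance of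
  a under K into invariance of its image under h.\<close>

lemma \<psi>_fixed: "\<psi> \<in> BS_fixed D n s \<rightarrow> BS_fixed D n' s'"
proof
  fix a assume a: "a \<in> BS_fixed D n s"
  then obtain c where c: "c \<in> C_seq D n s" "a = bs_class D n c"
    by (auto simp: BS_def BS_fixed_def)
  have "\<psi> a \<in> BS D n' s'"
    by (simp add: c \<psi>_bs_class BS_def F_C_seq)
  moreover have "left_act n' h (\<psi> a) = \<psi> a" if "h \<in> K" for h
  proof -
    have k: "matrix_inv g ** h ** g \<in> K"
      by (rule conj_K' [OF lies_g that])
    have "g ** (matrix_inv g ** h ** g) ** matrix_inv g = h"
      using invertible_g by (simp add: matrix_inv_right flip: matrix_mul_assoc)
    then show ?thesis
      using \<psi>_left_act [OF k, of a] a k by (simp add: BS_fixed_def)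
  qed
  ultimately show "\<psi> a \<in> BS_fixed D n' s'"
    by (simp add: BS_fixed_def)
qed

lemma \<psi>_gal_point: "\<gamma> \<in> galleries D n s \<Longrightarrow> \<psi> (gal_point D n \<gamma>) = gal_point D n' (\<phi> \<gamma>)"
  using \<psi>_bs_class [OF rep_gallery_C_seq] F_gallery by (simp add: gal_point_def [of D n])

end

theorem lemma13:
  fixes D :: "('e::euclidean_space, 'n::finite) chevalley_data"
    and n n' :: nat
    and s s' :: "nat \<Rightarrow> 'e \<Rightarrow> 'e"
    and p :: "nat \<Rightarrow> nat"
    and w :: "'e \<Rightarrow> 'e"
    and \<phi> :: "(nat \<Rightarrow> 'e \<Rightarrow> 'e) \<Rightarrow> nat \<Rightarrow> 'e \<Rightarrow> 'e"
  assumes "compact_chevalley D"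
    and "\<And>i. i \<in> {1..n} \<Longrightarrow> s i \<in> reflection ` simple_roots D"
    and "\<And>i. i \<in> {1..n'} \<Longrightarrow> s' i \<in> reflection ` simple_roots D"
    and "folding_morphism D n s n' s' p w \<phi>"
  shows "\<exists>\<psi>. continuous_map (BS_top D n s) (BS_top D n' s') \<psi> \<and>
     (\<forall>k\<in>compact_torus D. \<forall>a\<in>BS D n s.
        \<psi> (left_act n k a) = left_act n' (rep D w ** k ** matrix_inv (rep D w)) (\<psi> a)) \<and>
     \<psi> \<in> BS_fixed D n s \<rightarrow> BS_fixed D n' s' \<and>
     (\<forall>\<gamma>\<in>galleries D n s. \<psi> (gal_point D n \<gamma>) = gal_point D n' (\<phi> \<gamma>))"
proof -
  have "chevalley_basis (roots D) (simple_roots D) (root_vec D)"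
    using assms(1) by (simp add: compact_chevalley_def)
  then obtain H where H: "linear H"
      "\<forall>\<alpha>\<in>roots D. lie_bracket (root_vec D \<alpha>) (root_vec D (- \<alpha>)) = H (coroot \<alpha>)"
      "\<forall>\<alpha>\<in>roots D. \<forall>\<beta>\<in>roots D. lie_bracket (H (coroot \<alpha>)) (H (coroot \<beta>)) = 0"
      "\<forall>\<alpha>\<in>roots D. \<forall>\<beta>\<in>roots D. lie_bracket (H (coroot \<alpha>)) (root_vec D \<beta>)
        = mat (of_real (\<beta> \<bullet> coroot \<alpha>)) ** root_vec D \<beta>"
      "\<forall>a b. (\<Sum>\<alpha>\<in>roots D. mat (a \<alpha>) ** root_vec D \<alpha>)
        + (\<Sum>\<alpha>\<in>simple_roots D. mat (b \<alpha>) ** H (coroot \<alpha>)) = 0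
        \<longrightarrow> (\<forall>\<alpha>\<in>roots D. a \<alpha> = 0) \<and> (\<forall>\<alpha>\<in>simple_roots D. b \<alpha> = 0)"
    unfolding chevalley_basis_def by (elim conjE exE) (rule that)
  have "\<exists>\<iota>\<in>iso (weyl D) (Nrm D Mod compact_torus D).
      (\<forall>\<alpha>\<in>roots D. \<iota> (reflection \<alpha>) = omega D \<alpha> <#\<^bsub>GL\<^esub> compact_torus D) \<and>
      (\<forall>w\<in>carrier (weyl D). rep D w \<in> \<iota> w)"
    using assms(1) by (simp add: compact_chevalley_def)
  then obtain \<iota> where \<iota>: "\<iota> \<in> iso (weyl D) (Nrm D Mod compact_torus D)"
      "\<forall>\<alpha>\<in>roots D. \<iota> (reflection \<alpha>) = omega D \<alpha> <#\<^bsub>GL\<^esub> compact_torus D"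
      "\<forall>w\<in>carrier (weyl D). rep D w \<in> \<iota> w"
    by (elim bexE conjE) (rule that)
  \<comment> \<open>The locale is instantiated with the witnesses H and \<iota> extracted from the
    hypotheses.\<close>
  interpret folding D H \<iota> n n' s s' p w \<phi>
    by (intro folding.intro compact_chev.intro folding_axioms.intro) (use assms H \<iota> in blast)+
  show ?thesis
    using continuous_map_\<psi> \<psi>_left_act \<psi>_fixed \<psi>_gal_point unfolding g_def by blast
qed

end
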